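(* Let $n\geqslant 3$, $\lambda>0$, $\kappa>0$ and $\theta>0$. If the integral system $$u(x)=\int_{\mathbb{R}^n_+}|x-y|^\lambda v(y)^{-\kappa}\,dy\quad (x\in\partial\mathbb{R}^n_+),\qquad v(y)=\int_{\partial\mathbb{R}^n_+}|x-y|^\lambda u(x)^{-\theta}\,dx\quad (y\in\mathbb{R}^n_+)$$ admits a nonnegative $C^1$ solution $(u,v)$, with $u$ defined on $\partial\mathbb{R}^n_+$ and $v$ defined on $\mathbb{R}^n_+$, then $$\frac{n-1}{n}\,\frac{1}{\theta-1}+\frac1{\kappa-1}=\frac{\lambda}{n}.$$
   Context: $\mathbb{R}^n_+=\{y=(y',y_n)\in\mathbb{R}^n: y'\in\mathbb{R}^{n-1},\ y_n>0\}$, and its boundary $\partial\mathbb{R}^n_+$ is identified with $\mathbb{R}^{n-1}$ (with $(n-1)$-dimensional Lebesgue measure); for $x\in\partial\mathbb{R}^n_+$ and $y=(y',y_n)\in\mathbb{R}^n_+$, $|x-y|=\sqrt{|y'-x|^2+y_n^2}$. *)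

theory Defs
  imports "HOL-Analysis.Analysis"
begin

definition half_space :: "('a::real_normed_vector \<times> real) set" where
  "half_space = {y. snd y > 0}"

text \<open>The boundary of the half-space is the factor \<open>'a\<close>, embedded as \<open>x \<mapsto> (x, 0)\<close>.
  The norm of a pair is the Euclidean one, so this is \<open>sqrt (norm (y' - x)\<^sup>2 + y\<^sub>n\<^sup>2)\<close>.\<close>

definition bdist :: "'a::real_normed_vector \<Rightarrow> 'a \<times> real \<Rightarrow> real" where
  "bdist x y = norm ((x, 0) - y)"

text \<open>The power \<open>t\<close> to the \<open>-p\<close> for \<open>t \<ge> 0\<close>, \<open>p > 0\<close>, with value \<open>\<infinity>\<close> at \<open>t = 0\<close>
  (real \<open>powr\<close> would give \<open>0\<close> there, whereas \<open>inverse 0 = \<infinity>\<close> in \<^typ>\<open>ennreal\<close>).\<close>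

definition neg_powr :: "real \<Rightarrow> real \<Rightarrow> ennreal" where
  "neg_powr t p = inverse (ennreal (t powr p))"

text \<open>Meant for open \<open>S\<close>.\<close>

definition C1_on :: "'a::real_normed_vector set \<Rightarrow> ('a \<Rightarrow> real) \<Rightarrow> bool" where
  "C1_on S f \<longleftrightarrow> (\<exists>f' :: 'a \<Rightarrow> 'a \<Rightarrow>\<^sub>L real.
     (\<forall>x\<in>S. (f has_derivative blinfun_apply (f' x)) (at x)) \<and> continuous_on S f')"

text \<open>Values of \<open>v\<close> outside \<^const>\<open>half_space\<close> are irrelevant. The integrals are Lebesgue integrals
  of nonnegative functions; as \<open>u\<close> and \<open>v\<close> are real-valued, the equations force them to be finite.\<close>

definition nonneg_C1_solution ::
    "real \<Rightarrow> real \<Rightarrow> real \<Rightarrow> ('a::euclidean_space \<Rightarrow> real) \<Rightarrow> ('a \<times> real \<Rightarrow> real) \<Rightarrow> bool" where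
  "nonneg_C1_solution lam \<kappa> \<theta> u v \<longleftrightarrow>
     C1_on UNIV u \<and> C1_on half_space v \<and>
     (\<forall>x. u x \<ge> 0) \<and> (\<forall>y\<in>half_space. v y \<ge> 0) \<and>
     (\<forall>x. ennreal (u x) =
        (\<integral>\<^sup>+y\<in>half_space. ennreal (bdist x y powr lam) * neg_powr (v y) \<kappa> \<partial>lborel)) \<and>
     (\<forall>y\<in>half_space. ennreal (v y) =
        (\<integral>\<^sup>+x. ennreal (bdist x y powr lam) * neg_powr (u x) \<theta> \<partial>lborel))"

end

theory Submission
  imports Defs
begin

text \<open>
  Let \<open>I = \<integral> u\<^sup>1\<^sup>-\<^sup>\<theta> = \<integral> v\<^sup>1\<^sup>-\<^sup>\<kappa>\<close> and compare the dilation integrals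
  \<open>A \<tau> = \<integral> u (e\<^sup>\<tau> x) u(x)\<^sup>-\<^sup>\<theta> dx\<close> and \<open>B \<tau> = \<integral> v (e\<^sup>\<tau> y) v(y)\<^sup>-\<^sup>\<kappa> dy\<close>. By Fubini and homogeneity
  of the kernel, \<open>A \<tau> = e\<^bsup>\<lambda>\<tau>\<^esup> B (-\<tau>)\<close>. Expanding \<open>u (e\<^sup>\<tau> x)\<^sup>1\<^sup>-\<^sup>\<theta>\<close> to first order around \<open>u(x)\<close>
  and changing variables gives \<open>A' 0 = (n - 1) I / (\<theta> - 1)\<close>, and likewise
  \<open>B' 0 = n I / (\<kappa> - 1)\<close>; the claim is the derivative of the duality at \<open>0\<close>.

  The expansion only needs the relative error of \<open>u (e\<^sup>\<tau> x)\<close> to be \<open>O(\<bar>\<tau>\<bar>\<^sup>\<beta>)\<close> with \<open>\<beta> > 1/2\<close>, so that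
  its square is \<open>o(\<tau>)\<close>. For small \<open>\<lambda>\<close> the kernel alone gives less, but the second difference of
  \<open>u\<close> is the integral of a difference of the kernel against a difference of \<open>v\<^sup>-\<^sup>\<kappa>\<close>. Hence Hoelder
  exponents of kernel and \<open>v\<close> add up, and alternating between \<open>u\<close> and \<open>v\<close> one passes \<open>1/2\<close>.

  Boundary and half-space play symmetric roles: all that matters is that they are open cones and
  that the distance is homogeneous and Lipschitz in each variable.
\<close>

subsection \<open>Real inequalities\<close>

text \<open>After division by \<open>x + y\<close> both terms lie in \<open>[0, 1]\<close>, where
  \<open>z \<le> z powr p\<close> because \<open>p \<le> 1\<close>.\<close>

lemma powr_add_le:
  fixes x y p :: real
  assumes "0 \<le> x" "0 \<le> y" "0 < p" "p \<le> 1"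
  shows "(x + y) powr p \<le> x powr p + y powr p"
proof (cases "x + y = 0")
  case True
  then show ?thesis using assms by simp
next
  case False
  define s where "s = x + y"
  have s: "s > 0" using False assms by (simp add: s_def)
  have *: "z / s \<le> (z / s) powr p" if "0 \<le> z" "z \<le> s" for z
    using powr_mono'[of p 1 "z / s"] that s assms by (cases "z = 0") auto
  have "1 = x / s + y / s"
    using s by (simp add: s_def add_divide_distrib[symmetric])
  also have "\<dots> \<le> (x / s) powr p + (y / s) powr p"
    by (intro add_mono *) (use assms in \<open>auto simp: s_def\<close>)
  also have "\<dots> = (x powr p + y powr p) / s powr p"
    using assms s by (simp add: powr_divide add_divide_distrib)
  finally show ?thesis using s by (simp add: field_simps s_def)
qed

text \<open>For \<open>p \<le> 1\<close> this is subadditivity of the power, for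
  \<open>p > 1\<close> the mean value theorem, the derivative being at most \<open>p\<close> on the
  unit interval. Lowering the exponent to \<open>\<alpha>\<close> only enlarges a power of a number
  in \<open>[0, 1]\<close>.\<close>

lemma powr_diff_le:
  fixes a b p \<alpha> :: real
  assumes "0 \<le> b" "b \<le> a" "a \<le> 1" "0 < p" "0 < \<alpha>" "\<alpha> \<le> 1" "\<alpha> \<le> p"
  shows "a powr p - b powr p \<le> max 1 p * (a - b) powr \<alpha>"
proof (cases "p \<le> 1")
  case True
  have "a powr p \<le> b powr p + (a - b) powr p"
    using powr_add_le[of b "a - b" p] assms True by simp
  moreover have "(a - b) powr p \<le> (a - b) powr \<alpha>"
    using assms by (intro powr_mono') auto
  moreover have "max 1 p = 1" using True by simp
  ultimately show ?thesis by simp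
next
  case False
  have "a powr p - b powr p \<le> p * (a - b)"
  proof (cases "b = a")
    case False
    then have "b < a" using assms by simp
    have "\<exists>l z. b < z \<and> z < a \<and> ((\<lambda>z. z powr p) has_real_derivative l) (at z)
        \<and> a powr p - b powr p = (a - b) * l"
      using \<open>b < a\<close> assms
      by (intro MVT continuous_on_powr' continuous_on_id continuous_on_const)
        (auto intro!: exI has_real_derivative_powr simp: real_differentiable_def)
    then obtain l z where z: "b < z" "z < a" "((\<lambda>z. z powr p) has_real_derivative l) (at z)"
      "a powr p - b powr p = (a - b) * l" by blast
    have "l = p * z powr (p - 1)"
      using z assms by (intro DERIV_unique[OF z(3) has_real_derivative_powr]) auto
    have "z powr (p - 1) \<le> 1" using z assms \<open>\<not> p \<le> 1\<close> by (intro powr_le1) auto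
    then have "p * z powr (p - 1) \<le> p" using assms by simp
    then have "(a - b) * (p * z powr (p - 1)) \<le> (a - b) * p"
      using \<open>b < a\<close> by (intro mult_left_mono) auto
    with z \<open>l = _\<close> show ?thesis by (simp add: mult.commute)
  qed simp
  also have "a - b \<le> (a - b) powr \<alpha>"
    using powr_mono'[of \<alpha> 1 "a - b"] assms by (cases "a = b") auto
  finally show ?thesis using False assms by (simp add: max_def)
qed

text \<open>The derivative of the power is bounded on the half-line from \<open>min c 1\<close>,
  which contains both \<open>1\<close> and \<open>r\<close>.\<close>

lemma powr_neg_lipschitz:
  fixes c q :: real
  assumes "0 < c" "0 \<le> q"
  obtains L where "0 \<le> L"
    "\<And>r. c \<le> r \<Longrightarrow> \<bar>r powr (- q) - 1\<bar> \<le> L * \<bar>r - 1\<bar>"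
proof
  define m where "m = min c 1"
  have m: "0 < m" "m \<le> c" "m \<le> 1" using assms by (auto simp: m_def)
  show "0 \<le> q * m powr (- q - 1)" using assms by simp
  fix r assume "c \<le> r"
  have "norm (r powr (- q) - 1 powr (- q)) \<le> (q * m powr (- q - 1)) * norm (r - 1)"
  proof (rule field_differentiable_bound[where S = "{m..}" and f' = "\<lambda>z. - q * z powr (- q - 1)"])
    fix z assume "z \<in> {m..}"
    then have z: "m \<le> z" "0 < z" using m by auto
    show "((\<lambda>z. z powr (- q)) has_field_derivative - q * z powr (- q - 1)) (at z within {m..})"
      using z by (auto intro!: derivative_eq_intros simp: powr_diff)
    have "z powr (- q - 1) \<le> m powr (- q - 1)"
      using z m assms by (intro powr_mono2') auto
    then show "norm (- q * z powr (- q - 1)) \<le> q * m powr (- q - 1)"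
      using assms by (simp add: abs_mult mult_left_mono)
  qed (use m \<open>c \<le> r\<close> in auto)
  then show "\<bar>r powr (- q) - 1\<bar> \<le> q * m powr (- q - 1) * \<bar>r - 1\<bar>" by simp
qed

text \<open>The function \<open>z powr (1 - p) - (1 - p) * z\<close> has derivative
  \<open>(1 - p) * (z powr (- p) - 1)\<close>. By \<open>powr_neg_lipschitz\<close> this is of order
  \<open>\<bar>z - 1\<bar>\<close>, and the mean value inequality between \<open>1\<close> and
  \<open>r\<close> supplies the second factor.\<close>

lemma powr_taylor_bound:
  fixes c p :: real
  assumes "0 < c" "0 \<le> p"
  obtains L where "0 \<le> L"
    "\<And>r. c \<le> r \<Longrightarrow> \<bar>r powr (1 - p) - 1 - (1 - p) * (r - 1)\<bar> \<le> L * (r - 1)\<^sup>2"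
proof -
  define m where "m = min c 1"
  have m: "0 < m" "m \<le> c" "m \<le> 1" using assms by (auto simp: m_def)
  obtain L where L: "0 \<le> L" "\<And>r. m \<le> r \<Longrightarrow> \<bar>r powr (- p) - 1\<bar> \<le> L * \<bar>r - 1\<bar>"
    using powr_neg_lipschitz[OF m(1) assms(2)] by blast
  show thesis
  proof
    show "0 \<le> \<bar>1 - p\<bar> * L" using L by simp
    fix r assume "c \<le> r"
    define S where "S = {min r 1..max r 1}"
    define \<psi> where "\<psi> z = z powr (1 - p) - (1 - p) * z" for z :: real
    have "norm (\<psi> r - \<psi> 1) \<le> (\<bar>1 - p\<bar> * (L * \<bar>r - 1\<bar>)) * norm (r - 1)"
    proof (rule field_differentiable_bound[where S = S and f' = "\<lambda>z. (1 - p) * (z powr (- p) - 1)"])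
      fix z assume "z \<in> S"
      then have "min r 1 \<le> z" "z \<le> max r 1" by (auto simp: S_def)
      then have z: "m \<le> z" "0 < z" "\<bar>z - 1\<bar> \<le> \<bar>r - 1\<bar>"
        using m \<open>c \<le> r\<close> by linarith+
      show "(\<psi> has_field_derivative (1 - p) * (z powr (- p) - 1)) (at z within S)"
      proof -
        have "((\<lambda>z. z powr (1 - p)) has_field_derivative (1 - p) * z powr (1 - p - 1)) (at z within S)"
          using z(2) by (rule has_real_derivative_powr[THEN has_field_derivative_at_within])
        then have "(\<psi> has_field_derivative (1 - p) * z powr (1 - p - 1) - (1 - p) * 1) (at z within S)"
          unfolding \<psi>_def by (intro DERIV_diff DERIV_cmult DERIV_ident)
        then show ?thesis by (simp add: algebra_simps)
      qed
      have "\<bar>z powr (- p) - 1\<bar> \<le> L * \<bar>r - 1\<bar>"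
        using L(2)[OF z(1)] mult_left_mono[OF z(3) L(1)] by linarith
      then show "norm ((1 - p) * (z powr (- p) - 1)) \<le> \<bar>1 - p\<bar> * (L * \<bar>r - 1\<bar>)"
        by (simp add: abs_mult mult_left_mono)
    qed (auto simp: S_def)
    moreover have "\<psi> r - \<psi> 1 = r powr (1 - p) - 1 - (1 - p) * (r - 1)"
      by (simp add: \<psi>_def algebra_simps)
    moreover have "\<bar>r - 1\<bar> * \<bar>r - 1\<bar> = (r - 1)\<^sup>2"
      by (simp only: power2_eq_square abs_mult_self_eq)
    ultimately show "\<bar>r powr (1 - p) - 1 - (1 - p) * (r - 1)\<bar> \<le> \<bar>1 - p\<bar> * L * (r - 1)\<^sup>2"
      by (simp add: mult.assoc)
  qed
qed

text \<open>Turns control of second differences into control of \<open>\<delta>\<close> itself.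
  Passing from \<open>\<tau>\<close> to \<open>2 * \<tau>\<close> halves the weight of
  \<open>\<delta>\<close>, which beats the growth \<open>2 powr \<gamma>\<close> of the error since
  \<open>\<gamma> < 1\<close>; the errors collected until the argument has size about 1 form a
  convergent geometric series.\<close>

lemma doubling_bound:
  fixes \<delta> :: "real \<Rightarrow> real" and D \<gamma> \<tau> :: real
  assumes \<gamma>: "0 \<le> \<gamma>" "\<gamma> < 1" and D: "0 \<le> D"
    and bd: "\<And>\<tau>. \<bar>\<tau>\<bar> \<le> 1 \<Longrightarrow> \<bar>\<delta> \<tau>\<bar> \<le> D"
    and dbl: "\<And>\<tau>. \<bar>\<tau>\<bar> \<le> 1 \<Longrightarrow> \<bar>\<delta> (2 * \<tau>) - 2 * \<delta> \<tau>\<bar> \<le> D * \<bar>\<tau>\<bar> powr \<gamma>"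
    and \<tau>: "\<bar>\<tau>\<bar> \<le> 1"
  shows "\<bar>\<delta> \<tau>\<bar> \<le> 2 / (2 - 2 powr \<gamma>) * D * \<bar>\<tau>\<bar> powr \<gamma>"
proof -
  define a where "a = 2 powr \<gamma>"
  \<comment> \<open>Solves \<open>K * a + 2 = 2 * K\<close>, so a bound with constant
    \<open>K\<close> at \<open>2 * \<tau>\<close> reproduces itself at \<open>\<tau>\<close>. Also
    \<open>K \<ge> 2\<close>, which settles the range \<open>\<bar>\<tau>\<bar> > 1 / 2\<close>
    without any doubling.\<close>
  define K where "K = 2 / (2 - a)"
  have "2 powr \<gamma> < 2 powr (1::real)" using \<gamma> by (intro powr_less_mono) auto
  then have a: "1 \<le> a" "a < 2" using \<gamma> by (auto simp: a_def ge_one_powr_ge_zero)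
  have K: "K \<ge> 2" "K * a + 2 = 2 * K" using a by (auto simp: K_def field_simps)
  \<comment> \<open>Here \<open>k\<close> is a number of doublings that brings
    \<open>\<bar>\<tau>\<bar>\<close> up to at least 1.\<close>
  have main: "\<bar>\<delta> \<tau>\<bar> \<le> K * D * \<bar>\<tau>\<bar> powr \<gamma>" if "\<bar>\<tau>\<bar> \<le> 1" "1 \<le> 2 ^ k * \<bar>\<tau>\<bar>" for k \<tau>
    using that
  proof (induction k arbitrary: \<tau>)
    case 0
    then have "\<bar>\<tau>\<bar> = 1" by simp
    then have "\<bar>\<delta> \<tau>\<bar> \<le> D" using bd by simp
    also have "\<dots> \<le> K * D" using mult_right_mono[of 1 K D] K D by simp
    finally show ?case using \<open>\<bar>\<tau>\<bar> = 1\<close> by simp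
  next
    case (Suc k)
    show ?case
    proof (cases "\<bar>\<tau>\<bar> \<le> 1 / 2")
      case True
      have IH: "\<bar>\<delta> (2 * \<tau>)\<bar> \<le> K * D * \<bar>2 * \<tau>\<bar> powr \<gamma>"
        using Suc True by (intro Suc.IH) (auto simp: abs_mult mult_ac)
      have "2 * \<bar>\<delta> \<tau>\<bar> \<le> \<bar>\<delta> (2 * \<tau>)\<bar> + D * \<bar>\<tau>\<bar> powr \<gamma>"
        using dbl[of \<tau>] Suc.prems by linarith
      also have "\<dots> \<le> K * D * (a * \<bar>\<tau>\<bar> powr \<gamma>) + D * \<bar>\<tau>\<bar> powr \<gamma>"
        using IH by (simp add: a_def abs_mult powr_mult)
      also have "\<dots> = (K * a + 1) * (D * \<bar>\<tau>\<bar> powr \<gamma>)" by (simp add: algebra_simps)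
      also have "\<dots> \<le> (2 * K) * (D * \<bar>\<tau>\<bar> powr \<gamma>)"
        using K D by (intro mult_right_mono) auto
      finally show ?thesis by (simp add: mult_ac)
    next
      case False
      have "1 / 2 \<le> \<bar>\<tau>\<bar>" using False by simp
      also have "\<bar>\<tau>\<bar> \<le> \<bar>\<tau>\<bar> powr \<gamma>"
        using powr_mono'[of \<gamma> 1 "\<bar>\<tau>\<bar>"] \<gamma> Suc.prems False by auto
      finally have "K * (1 / 2) \<le> K * \<bar>\<tau>\<bar> powr \<gamma>" using K by (intro mult_left_mono) auto
      then have "1 \<le> K * \<bar>\<tau>\<bar> powr \<gamma>" using K by linarith
      then have "D * 1 \<le> D * (K * \<bar>\<tau>\<bar> powr \<gamma>)" using D by (intro mult_left_mono) auto
      then show ?thesis using bd[OF Suc.prems(1)] by (simp add: mult_ac)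
    qed
  qed
  show ?thesis
  proof (cases "\<tau> = 0")
    case True
    \<comment> \<open>Since \<open>0 powr \<gamma> = 0\<close> even for \<open>\<gamma> = 0\<close>,
      the doubling hypothesis at \<open>0\<close> forces \<open>\<delta> 0 = 0\<close>.\<close>
    then show ?thesis using dbl[of 0] by simp
  next
    case False
    obtain k where "1 / \<bar>\<tau>\<bar> < 2 ^ k" using real_arch_pow[of 2 "1 / \<bar>\<tau>\<bar>"] by auto
    then have "1 \<le> 2 ^ k * \<bar>\<tau>\<bar>" using False by (simp add: field_simps)
    from main[OF \<tau> this] show ?thesis by (simp add: K_def a_def)
  qed
qed

lemma abs_exp_minus_one_le:
  fixes x :: real
  shows "\<bar>exp x - 1\<bar> \<le> \<bar>x\<bar> * exp \<bar>x\<bar>"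
proof (cases "0 \<le> x")
  case True
  have "1 - x \<le> exp (- x)" using exp_ge_add_one_self[of "- x"] by simp
  then have "exp x * (1 - x) \<le> exp x * exp (- x)" by (intro mult_left_mono) auto
  then have "exp x - 1 \<le> x * exp x" by (simp add: exp_minus algebra_simps)
  with True show ?thesis by simp
next
  case False
  have "\<bar>exp x - 1\<bar> \<le> \<bar>x\<bar>"
  proof -
    have "exp x < 1" using False by simp
    with False exp_ge_add_one_self[of x] show ?thesis by linarith
  qed
  also have "\<dots> \<le> \<bar>x\<bar> * exp \<bar>x\<bar>"
    using mult_left_mono[of 1 "exp \<bar>x\<bar>" "\<bar>x\<bar>"] by simp
  finally show ?thesis .
qed

subsection \<open>Lebesgue measure and dilations\<close>

lemma lborel_scaleR:
  fixes h :: "'a::euclidean_space \<Rightarrow> real" and c :: real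
  assumes [measurable]: "h \<in> borel_measurable borel" and c: "0 < c"
  shows integrable_lborel_scaleR: "integrable lborel (\<lambda>x. h (c *\<^sub>R x)) \<longleftrightarrow> integrable lborel h"
    and integral_lborel_scaleR:
      "(LINT x|lborel. h (c *\<^sub>R x)) = (LINT x|lborel. h x) / c ^ DIM('a)"
proof -
  have eq: "lborel = density (distr lborel borel (\<lambda>x::'a. 0 + c *\<^sub>R x)) (\<lambda>_. ennreal (\<bar>c\<bar> ^ DIM('a)))"
    using c by (intro lborel_affine) auto
  have "integrable lborel h \<longleftrightarrow> integrable lborel (\<lambda>x. c ^ DIM('a) *\<^sub>R h (c *\<^sub>R x))"
    by (subst eq) (use c in \<open>simp add: integrable_density integrable_distr_eq\<close>)
  then show "integrable lborel (\<lambda>x. h (c *\<^sub>R x)) \<longleftrightarrow> integrable lborel h"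
    using c by simp
  have "(LINT x|lborel. h x) = (LINT x|lborel. c ^ DIM('a) *\<^sub>R h (c *\<^sub>R x))"
    by (subst eq) (use c in \<open>simp add: integral_density integral_distr\<close>)
  then show "(LINT x|lborel. h (c *\<^sub>R x)) = (LINT x|lborel. h x) / c ^ DIM('a)"
    using c by simp
qed

lemma not_AE_notin_open:
  fixes S :: "'a::euclidean_space set"
  assumes "open S" "S \<noteq> {}"
  shows "\<not> (AE x in lborel. x \<notin> S)"
proof
  assume "AE x in lborel. x \<notin> S"
  then have "S \<in> null_sets lborel"
    using assms by (subst (asm) AE_iff_null_sets[symmetric]) auto
  then have "negligible S"
    by (simp add: negligible_iff_null_sets null_sets_completionI)
  with open_not_negligible assms show False by blast
qed

lemma integral_pos_of_pos_on_open:
  fixes h :: "'a::euclidean_space \<Rightarrow> real"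
  assumes h: "integrable lborel h" and nonneg: "\<And>x. 0 \<le> h x"
    and S: "open S" "S \<noteq> {}" and pos: "\<And>x. x \<in> S \<Longrightarrow> 0 < h x"
  shows "0 < (LINT x|lborel. h x)"
proof (rule ccontr)
  assume "\<not> 0 < (LINT x|lborel. h x)"
  then have "(LINT x|lborel. h x) = 0"
    using nonneg by (simp add: integral_nonneg_AE order.antisym)
  then have "AE x in lborel. h x = 0"
    using integral_nonneg_eq_0_iff_AE[OF h] nonneg by simp
  then have "AE x in lborel. x \<notin> S"
    by eventually_elim (use pos in force)
  with not_AE_notin_open S show False by blast
qed

subsection \<open>Homogeneous kernels\<close>

text \<open>The common growth rate of the potentials: \<open>u_upper\<close> and
  \<open>u_lower\<close> make \<open>u\<close> comparable to it, so errors measured against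
  \<open>weight\<close> are relative errors.\<close>

definition weight :: "real \<Rightarrow> 'a::real_normed_vector \<Rightarrow> real" where
  "weight lam x = (1 + norm x) powr lam"

lemma weight_pos: "0 < weight lam x"
  using add_pos_nonneg[OF zero_less_one norm_ge_zero[of x]] by (simp add: weight_def)

lemma abs_weight [simp]: "\<bar>weight lam x\<bar> = weight lam x"
  by (simp add: weight_def)

lemma weight_measurable [measurable]: "weight lam \<in> borel_measurable borel"
  unfolding weight_def by measurable

lemma weight_ge_one: "0 \<le> lam \<Longrightarrow> 1 \<le> weight lam x"
  by (simp add: weight_def ge_one_powr_ge_zero)

lemma weight_scaleR_le:
  assumes "0 \<le> lam" "1 \<le> c" "\<bar>t\<bar> \<le> c"
  shows "weight lam (t *\<^sub>R x) \<le> c powr lam * weight lam x"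
proof -
  have "1 + norm (t *\<^sub>R x) \<le> c * (1 + norm x)"
    using assms mult_right_mono[of "\<bar>t\<bar>" c "norm x"] by (simp add: algebra_simps)
  then have "(1 + norm (t *\<^sub>R x)) powr lam \<le> (c * (1 + norm x)) powr lam"
    using assms by (intro powr_mono2) auto
  then show ?thesis using assms by (simp add: weight_def powr_mult)
qed

lemma weight_exp_le:
  assumes "0 \<le> lam" "\<bar>\<tau>\<bar> \<le> 2"
  shows "weight lam (exp \<tau> *\<^sub>R x) \<le> 9 powr lam * weight lam x"
proof (rule weight_scaleR_le)
  have "exp \<tau> \<le> exp (1 + 1)" using assms by simp
  also have "\<dots> \<le> 3 * 3" unfolding exp_add using exp_le by (intro mult_mono) auto
  finally show "\<bar>exp \<tau>\<bar> \<le> 9" by simp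
qed (use assms in auto)

text \<open>The kernel is an argument so that the second equation is covered by the flipped kernel
  \<open>\<lambda>y x. d x y\<close>.\<close>

definition potential ::
    "('x \<Rightarrow> 'y \<Rightarrow> real) \<Rightarrow> real \<Rightarrow> ('y::euclidean_space \<Rightarrow> real) \<Rightarrow> 'x \<Rightarrow> real" where
  "potential d lam g x = (LINT y|lborel. d x y powr lam * g y)"

text \<open>The two variables live in different spaces, so no triangle inequality between them can
  be stated. The Lipschitz bounds together with the values at the origin take its place and yield
  \<open>d_upper\<close> and \<open>d_lower\<close>.\<close>

locale homogeneous_kernel =
  fixes d :: "'x::euclidean_space \<Rightarrow> 'y::euclidean_space \<Rightarrow> real" and lam :: real
  assumes d_scaleR: "0 < t \<Longrightarrow> d (t *\<^sub>R x) (t *\<^sub>R y) = t * d x y"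
    and d_lipschitz1: "\<bar>d x y - d x' y\<bar> \<le> norm (x - x')"
    and d_lipschitz2: "\<bar>d x y - d x y'\<bar> \<le> norm (y - y')"
    and d_zero1: "d 0 y = norm y"
    and d_zero2: "d x 0 = norm x"
    and lam_pos: "0 < lam"
begin

lemma kernel_swap: "homogeneous_kernel (\<lambda>y x. d x y) lam"
  by unfold_locales
    (simp_all add: d_scaleR d_lipschitz1 d_lipschitz2 d_zero1 d_zero2 lam_pos)

lemma d_upper: "d x y \<le> norm x + norm y"
  using d_lipschitz1[of x y 0] by (simp add: d_zero1)

lemma d_lower: "\<bar>norm x - norm y\<bar> \<le> d x y"
  using d_lipschitz1[of x y 0] d_lipschitz2[of x y 0] by (simp add: d_zero1 d_zero2)

lemma d_nonneg [simp]: "0 \<le> d x y"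
  using d_lower[of x y] by linarith

lemma continuous_d: "continuous_on UNIV (\<lambda>z. d (fst z) (snd z))"
proof (rule continuous_on_iff[THEN iffD2], intro ballI allI impI)
  fix z :: "'x \<times> 'y" and e :: real
  assume "e > 0"
  show "\<exists>\<delta>>0. \<forall>z'\<in>UNIV. dist z' z < \<delta> \<longrightarrow> dist (d (fst z') (snd z')) (d (fst z) (snd z)) < e"
  proof (intro exI conjI ballI impI)
    fix z' assume *: "dist z' z < e / 2"
    have "\<bar>d (fst z') (snd z') - d (fst z) (snd z)\<bar>
        \<le> norm (fst z' - fst z) + norm (snd z' - snd z)"
      using d_lipschitz1[of "fst z'" "snd z'" "fst z"] d_lipschitz2[of "fst z" "snd z'" "snd z"]
      by linarith
    also have "\<dots> = norm (fst (z' - z)) + norm (snd (z' - z))" by simp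
    also have "\<dots> \<le> norm (z' - z) + norm (z' - z)"
      using norm_fst_le[of "fst (z' - z)" "snd (z' - z)"]
        norm_snd_le[of "snd (z' - z)" "fst (z' - z)"]
      unfolding prod.collapse by (rule add_mono)
    finally show "dist (d (fst z') (snd z')) (d (fst z) (snd z)) < e"
      using * by (simp add: dist_norm)
  qed (use \<open>e > 0\<close> in simp)
qed

lemma d_measurable [measurable]:
  assumes [measurable]: "a \<in> borel_measurable M" "b \<in> borel_measurable M"
  shows "(\<lambda>z. d (a z) (b z)) \<in> borel_measurable M"
proof -
  have "(\<lambda>z. d (fst z) (snd z)) \<in> borel_measurable borel"
    by (intro borel_measurable_continuous_onI continuous_d)
  then have "(\<lambda>z. d (fst z) (snd z)) \<circ> (\<lambda>z. (a z, b z)) \<in> borel_measurable M"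
    by (intro measurable_comp) (auto simp: borel_prod[symmetric])
  then show ?thesis by (simp add: comp_def)
qed

section \<open>Growth and Hoelder continuity of the kernel\<close>

lemma kernel_le: "d x y powr lam \<le> weight lam x * weight lam y"
proof -
  have "d x y \<le> (1 + norm x) * (1 + norm y)"
    using d_upper[of x y] mult_nonneg_nonneg[OF norm_ge_zero[of x] norm_ge_zero[of y]]
    unfolding distrib_left distrib_right by linarith
  then have "d x y powr lam \<le> ((1 + norm x) * (1 + norm y)) powr lam"
    using lam_pos by (intro powr_mono2) auto
  then show ?thesis by (simp add: weight_def powr_mult)
qed

text \<open>Dividing both distances by a common bound \<open>m\<close> puts them into
  \<open>[0, 1]\<close> at mutual distance at most \<open>\<bar>\<tau>\<bar>\<close>, where
  \<open>powr_diff_le\<close> applies. Scaling back costs the factor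
  \<open>m powr lam\<close>.\<close>

lemma kernel_holder:
  assumes \<alpha>: "0 < \<alpha>" "\<alpha> \<le> 1" "\<alpha> \<le> lam" and \<tau>: "\<bar>\<tau>\<bar> \<le> 1"
  shows "\<bar>d (exp \<tau> *\<^sub>R x) y powr lam - d x y powr lam\<bar>
    \<le> max 1 lam * 3 powr lam * \<bar>\<tau>\<bar> powr \<alpha> * (weight lam x * weight lam y)"
proof -
  \<comment> \<open>The product form makes \<open>m powr lam\<close> split into the two weights. The
    factor 3 absorbs \<open>exp \<tau>\<close> and the bound
    \<open>\<bar>exp \<tau> - 1\<bar> \<le> 3 * \<bar>\<tau>\<bar>\<close>.\<close>
  define m where "m = 3 * ((1 + norm x) * (1 + norm y))"
  have m1: "3 + 3 * norm x + 3 * norm y \<le> m" by (simp add: m_def algebra_simps)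
  have m0: "0 < m" unfolding m_def by (intro mult_pos_pos add_pos_nonneg) auto
  define a b where "a = d (exp \<tau> *\<^sub>R x) y / m" and "b = d x y / m"
  have "exp \<tau> \<le> 3" using \<tau> exp_le exp_le_cancel_iff[of \<tau> 1] by linarith
  then have "exp \<tau> * norm x \<le> 3 * norm x" by (intro mult_right_mono) auto
  then have "d (exp \<tau> *\<^sub>R x) y \<le> m"
    using d_upper[of "exp \<tau> *\<^sub>R x" y] m1 norm_ge_zero[of x] norm_ge_zero[of y]
    unfolding norm_scaleR abs_exp_cancel by linarith
  then have a: "0 \<le> a" "a \<le> 1" using m0 by (auto simp: a_def)
  have b: "0 \<le> b" "b \<le> 1"
  proof -
    have "d x y \<le> m" using d_upper[of x y] m1 norm_ge_zero[of x] norm_ge_zero[of y] by linarith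
    then show "0 \<le> b" "b \<le> 1" using m0 by (auto simp: b_def)
  qed
  have "\<bar>d (exp \<tau> *\<^sub>R x) y - d x y\<bar> \<le> norm ((exp \<tau> - 1) *\<^sub>R x)"
    using d_lipschitz1[of "exp \<tau> *\<^sub>R x" y x] by (simp add: algebra_simps)
  also have "\<dots> \<le> 3 * \<bar>\<tau>\<bar> * norm x"
  proof -
    have "exp \<bar>\<tau>\<bar> \<le> exp 1" using \<tau> by simp
    then have "exp \<bar>\<tau>\<bar> \<le> 3" using exp_le by linarith
    then have "\<bar>\<tau>\<bar> * exp \<bar>\<tau>\<bar> \<le> \<bar>\<tau>\<bar> * 3" by (intro mult_left_mono) auto
    then have "\<bar>exp \<tau> - 1\<bar> \<le> 3 * \<bar>\<tau>\<bar>" using abs_exp_minus_one_le[of \<tau>] by linarith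
    then show ?thesis by (simp add: mult_right_mono)
  qed
  also have "\<dots> = \<bar>\<tau>\<bar> * (3 * norm x)" by simp
  also have "\<dots> \<le> \<bar>\<tau>\<bar> * m"
  proof (rule mult_left_mono)
    show "3 * norm x \<le> m" using m1 norm_ge_zero[of x] norm_ge_zero[of y] by linarith
  qed simp
  finally have ab: "\<bar>a - b\<bar> \<le> \<bar>\<tau>\<bar>"
    using m0 by (simp add: a_def b_def diff_divide_distrib[symmetric] field_simps)
  have "\<bar>a powr lam - b powr lam\<bar> \<le> max 1 lam * \<bar>a - b\<bar> powr \<alpha>"
  proof (cases "b \<le> a")
    case True
    then have "b powr lam \<le> a powr lam" using b lam_pos by (intro powr_mono2) auto
    then show ?thesis using powr_diff_le[of b a lam \<alpha>] True a b \<alpha> lam_pos by simp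
  next
    case False
    then have "a powr lam \<le> b powr lam" using a lam_pos by (intro powr_mono2) auto
    then show ?thesis using powr_diff_le[of a b lam \<alpha>] False a b \<alpha> lam_pos by simp
  qed
  also have "\<dots> \<le> max 1 lam * \<bar>\<tau>\<bar> powr \<alpha>"
    using ab \<alpha> by (intro mult_left_mono powr_mono2) auto
  finally have "m powr lam * \<bar>a powr lam - b powr lam\<bar> \<le> m powr lam * (max 1 lam * \<bar>\<tau>\<bar> powr \<alpha>)"
    by (intro mult_left_mono) auto
  also have "m powr lam * \<bar>a powr lam - b powr lam\<bar>
      = \<bar>m powr lam * a powr lam - m powr lam * b powr lam\<bar>"
    by (simp add: abs_mult right_diff_distrib[symmetric])
  also have "m powr lam * a powr lam = d (exp \<tau> *\<^sub>R x) y powr lam"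
    using m0 by (simp add: a_def powr_mult[symmetric])
  also have "m powr lam * b powr lam = d x y powr lam"
    using m0 by (simp add: b_def powr_mult[symmetric])
  also have "m powr lam = 3 powr lam * (weight lam x * weight lam y)"
    by (simp add: m_def weight_def powr_mult)
  finally show ?thesis by (simp add: mult_ac)
qed

end

subsection \<open>Integral systems on open cones\<close>

text \<open>
  The unknowns are \<open>f = u\<^sup>-\<^sup>p\<close> on \<open>P\<close> and \<open>g = v\<^sup>-\<^sup>q\<close> on \<open>Q\<close>, extended by zero; \<open>u\<close> and \<open>v\<close> are
  recovered as their potentials, which are then defined on the whole space.
\<close>

locale cone_system = homogeneous_kernel d lam
  for d :: "'x::euclidean_space \<Rightarrow> 'y::euclidean_space \<Rightarrow> real" and lam :: real +
  fixes P :: "'x set" and Q :: "'y set" and p q :: real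
    and f :: "'x \<Rightarrow> real" and g :: "'y \<Rightarrow> real"
  assumes P_open: "open P" "P \<noteq> {}" and Q_open: "open Q" "Q \<noteq> {}"
    and P_cone: "x \<in> P \<Longrightarrow> 0 < t \<Longrightarrow> t *\<^sub>R x \<in> P"
    and Q_cone: "y \<in> Q \<Longrightarrow> 0 < t \<Longrightarrow> t *\<^sub>R y \<in> Q"
    and p_pos: "0 < p" and q_pos: "0 < q"
    and f_measurable [measurable]: "f \<in> borel_measurable borel"
    and g_measurable [measurable]: "g \<in> borel_measurable borel"
    and f_pos: "x \<in> P \<Longrightarrow> 0 < f x" and f_zero: "x \<notin> P \<Longrightarrow> f x = 0"
    and g_pos: "y \<in> Q \<Longrightarrow> 0 < g y" and g_zero: "y \<notin> Q \<Longrightarrow> g y = 0"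
    and integrable_g_at: "x \<in> P \<Longrightarrow> integrable lborel (\<lambda>y. d x y powr lam * g y)"
    and integrable_f_at: "y \<in> Q \<Longrightarrow> integrable lborel (\<lambda>x. d x y powr lam * f x)"
    and f_eq: "x \<in> P \<Longrightarrow> f x = potential d lam g x powr (- p)"
    and g_eq: "y \<in> Q \<Longrightarrow> g y = potential (\<lambda>y x. d x y) lam f y powr (- q)"
begin

text \<open>The assumptions are symmetric, so interpreting the locale along this rule (as
  \<open>sw\<close> below) gives every result about \<open>u\<close> and \<open>g\<close> for
  \<open>v\<close> and \<open>f\<close> as well.\<close>

lemma swap: "cone_system (\<lambda>y x. d x y) lam Q P q p g f"
  by (intro cone_system.intro kernel_swap cone_system_axioms.intro)
    (assumption | rule P_open Q_open P_cone Q_cone p_pos q_pos f_measurable g_measurable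
      f_pos f_zero g_pos g_zero integrable_g_at integrable_f_at f_eq g_eq)+

section \<open>Integrability of the densities and two-sided growth bounds for the potential\<close>

abbreviation "u \<equiv> potential d lam g"
abbreviation "v \<equiv> potential (\<lambda>y x. d x y) lam f"

lemma f_nonneg [simp]: "0 \<le> f x"
  using f_pos[of x] f_zero[of x] by (cases "x \<in> P") auto

lemma g_nonneg [simp]: "0 \<le> g y"
  using g_pos[of y] g_zero[of y] by (cases "y \<in> Q") auto

text \<open>No \<open>y\<close> is close to both \<open>x\<close> and \<open>2 *\<^sub>R x\<close>
  when \<open>x \<noteq> 0\<close>, so the larger of the two distances dominates a multiple of
  \<open>1 + norm y\<close>. Finiteness of \<open>u\<close> at these two points of \<open>P\<close>
  therefore suffices.\<close>

lemma integrable_weight_g: "integrable lborel (\<lambda>y. weight lam y * g y)"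
proof -
  have "P \<noteq> {0}" using P_open not_open_singleton[of "0::'x"] by auto
  then obtain x where x: "x \<in> P" "x \<noteq> 0" using P_open by blast
  define n where "n = norm x"
  have n: "n > 0" using x by (simp add: n_def)
  have x2: "2 *\<^sub>R x \<in> P" using P_cone x by simp
  define K where "K = 2 * (2 + 1 / n)"
  have K: "K > 0" using n by (simp add: K_def add_pos_pos)
  define k where "k y = K powr lam * (d x y powr lam * g y + d (2 *\<^sub>R x) y powr lam * g y)" for y
  have int: "integrable lborel k"
    unfolding k_def
    by (intro integrable_mult_right Bochner_Integration.integrable_add integrable_g_at x x2)
  have le: "weight lam y * g y \<le> k y" for y
  proof -
    define a b where "a = d x y" and "b = d (2 *\<^sub>R x) y"
    have ab: "0 \<le> a" "0 \<le> b" by (auto simp: a_def b_def)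
    have "\<bar>n - norm y\<bar> \<le> a" "\<bar>2 * n - norm y\<bar> \<le> b"
      using d_lower[of x y] d_lower[of "2 *\<^sub>R x" y] by (auto simp: a_def b_def n_def)
    then have 1: "n \<le> a + b" "norm y \<le> a + n" by linarith+
    define t where "t = (1 / n) * (a + b)"
    have 2: "1 \<le> t" using n 1 by (simp add: t_def field_simps)
    have "1 + norm y \<le> t + 2 * a + 2 * b" using 1 2 ab by linarith
    also have "\<dots> = (2 + 1 / n) * (a + b)" by (simp add: t_def algebra_simps)
    also have "\<dots> \<le> (2 + 1 / n) * (2 * max a b)"
      using n by (intro mult_left_mono) auto
    also have "\<dots> = K * max a b" by (simp only: K_def mult_ac)
    finally have "1 + norm y \<le> K * max a b" .
    then have "weight lam y \<le> (K * max a b) powr lam"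
      unfolding weight_def using lam_pos by (intro powr_mono2) auto
    also have "\<dots> = K powr lam * max a b powr lam" using K ab by (simp add: powr_mult)
    also have "\<dots> \<le> K powr lam * (a powr lam + b powr lam)"
      by (intro mult_left_mono) (auto simp: max_def)
    finally have "weight lam y * g y \<le> K powr lam * (a powr lam + b powr lam) * g y"
      by (intro mult_right_mono) auto
    then show ?thesis by (simp add: k_def a_def b_def algebra_simps)
  qed
  show ?thesis
  proof (rule Bochner_Integration.integrable_bound[OF int])
    show "AE y in lborel. norm (weight lam y * g y) \<le> norm (k y)"
      using le by (auto intro!: AE_I2 order.trans[OF le] simp: abs_mult)
  qed measurable
qed

lemma integral_weight_g_nonneg: "0 \<le> (LINT y|lborel. weight lam y * g y)"
  by (intro integral_nonneg_AE AE_I2 mult_nonneg_nonneg less_imp_le[OF weight_pos]) simp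

text \<open>Extends \<open>integrable_g_at\<close> from \<open>P\<close> to every \<open>x\<close>,
  by \<open>kernel_le\<close>.\<close>

lemma integrable_kernel_g: "integrable lborel (\<lambda>y. d x y powr lam * g y)"
proof (rule Bochner_Integration.integrable_bound)
  show "integrable lborel (\<lambda>y. weight lam x * (weight lam y * g y))"
    by (intro integrable_mult_right integrable_weight_g)
  show "AE y in lborel. norm (d x y powr lam * g y) \<le> norm (weight lam x * (weight lam y * g y))"
    using mult_right_mono[OF kernel_le g_nonneg] by (intro AE_I2) (simp add: abs_mult mult_ac)
qed measurable

lemma integrable_g: "integrable lborel g"
proof (rule Bochner_Integration.integrable_bound[OF integrable_weight_g])
  show "AE y in lborel. norm (g y) \<le> norm (weight lam y * g y)"
    using mult_right_mono[OF weight_ge_one[of lam] g_nonneg] lam_pos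
    by (intro AE_I2) (simp add: abs_mult)
qed measurable

lemma integrable_indicator_g:
  "S \<in> sets borel \<Longrightarrow> integrable lborel (\<lambda>y. indicator S y * g y)"
  using integrable_mult_indicator[of S lborel g] integrable_g by simp

lemma u_measurable [measurable]: "u \<in> borel_measurable borel"
  unfolding potential_def[abs_def] by measurable

lemma u_nonneg: "0 \<le> u x"
  unfolding potential_def by (intro integral_nonneg_AE AE_I2) simp

lemma u_upper: "u x \<le> weight lam x * (LINT y|lborel. weight lam y * g y)"
  unfolding potential_def integral_mult_right_zero[symmetric]
proof (intro integral_mono integrable_kernel_g integrable_mult_right integrable_weight_g)
  fix y show "d x y powr lam * g y \<le> weight lam x * (weight lam y * g y)"
    using mult_right_mono[OF kernel_le g_nonneg] by (simp add: mult_ac)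
qed

lemma integral_g_open_pos:
  assumes "open S" "y \<in> Q" "y \<in> S"
  shows "0 < (LINT y|lborel. indicator S y * g y)"
proof (rule integral_pos_of_pos_on_open)
  show "integrable lborel (\<lambda>y. indicator S y * g y)"
    using assms by (intro integrable_indicator_g) auto
  show "open (S \<inter> Q)" "S \<inter> Q \<noteq> {}" using assms Q_open by auto
qed (auto simp: g_pos)

lemma u_lower_of_kernel_lower:
  assumes S: "S \<in> sets borel" and "\<And>y. y \<in> S \<Longrightarrow> a \<le> d x y powr lam"
  shows "a * (LINT y|lborel. indicator S y * g y) \<le> u x"
  unfolding potential_def integral_mult_right_zero[symmetric]
proof (intro integral_mono integrable_kernel_g integrable_mult_right)
  show "integrable lborel (\<lambda>y. indicator S y * g y)"
    using S by (rule integrable_indicator_g)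
  fix y show "a * (indicator S y * g y) \<le> d x y powr lam * g y"
    using assms(2)[of y] by (auto simp: indicator_def mult_right_mono)
qed

text \<open>Since \<open>Q\<close> is an open cone, \<open>g\<close> has positive mass both in the
  unit ball and outside the ball of radius 3. The near mass bounds \<open>u x\<close> from below
  when \<open>norm x \<ge> 2\<close>, the far mass otherwise.\<close>

lemma u_lower: obtains c where "0 < c" "\<And>x. c * weight lam x \<le> u x"
proof -
  have "Q \<noteq> {0}" using Q_open not_open_singleton[of "0::'y"] by auto
  then obtain y where y: "y \<in> Q" "y \<noteq> 0" using Q_open by blast
  define m1 where "m1 = (LINT y|lborel. indicator (ball 0 1) y * g y)"
  define m2 where "m2 = (LINT y|lborel. indicator (- cball 0 3) y * g y)"
  have "(1 / (2 * norm y)) *\<^sub>R y \<in> Q" using y by (intro Q_cone[OF y(1)]) simp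
  moreover have "(1 / (2 * norm y)) *\<^sub>R y \<in> ball 0 1" using y by simp
  ultimately have m1: "0 < m1" unfolding m1_def by (intro integral_g_open_pos open_ball)
  have "(4 / norm y) *\<^sub>R y \<in> Q" using y by (intro Q_cone[OF y(1)]) simp
  moreover have "(4 / norm y) *\<^sub>R y \<in> - cball 0 3" using y by simp
  ultimately have m2: "0 < m2" unfolding m2_def
    by (intro integral_g_open_pos open_Compl closed_cball)
  define c where "c = min (m1 / 4 powr lam) (m2 / 4 powr lam)"
  show thesis
  proof
    show "0 < c" using m1 m2 by (simp add: c_def)
    fix x
    show "c * weight lam x \<le> u x"
    proof (cases "2 \<le> norm x")
      case True
      have "weight lam x / 4 powr lam * m1 \<le> u x"
        unfolding m1_def
      proof (rule u_lower_of_kernel_lower)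
        fix y :: 'y assume "y \<in> ball 0 1"
        then have "(1 + norm x) / 4 \<le> d x y" using d_lower[of x y] True by auto
        then have "((1 + norm x) / 4) powr lam \<le> d x y powr lam"
          using lam_pos by (intro powr_mono2) auto
        then show "weight lam x / 4 powr lam \<le> d x y powr lam"
          by (simp add: weight_def powr_divide)
      qed auto
      moreover have "c * weight lam x \<le> m1 / 4 powr lam * weight lam x"
        using weight_pos[of lam x] by (intro mult_right_mono) (auto simp: c_def)
      ultimately show ?thesis by (simp add: mult_ac)
    next
      case False
      have "1 * m2 \<le> u x"
        unfolding m2_def
      proof (rule u_lower_of_kernel_lower)
        fix y :: 'y assume "y \<in> - cball 0 3"
        then have "1 \<le> d x y" using d_lower[of x y] False by auto
        then show "1 \<le> d x y powr lam" using lam_pos by (simp add: ge_one_powr_ge_zero)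
      qed auto
      moreover have "weight lam x \<le> 4 powr lam"
        unfolding weight_def using False lam_pos by (intro powr_mono2) auto
      then have "m2 / 4 powr lam * weight lam x \<le> m2"
        using m2 by (simp add: field_simps)
      moreover have "c * weight lam x \<le> m2 / 4 powr lam * weight lam x"
        using weight_pos[of lam x] by (intro mult_right_mono) (auto simp: c_def)
      ultimately show ?thesis by linarith
    qed
  qed
qed

lemma u_pos: "0 < u x"
proof -
  obtain c where c: "0 < c" "\<And>x. c * weight lam x \<le> u x" using u_lower by blast
  have "0 < c * weight lam x" using c(1) weight_pos[of lam x] by simp
  with c(2)[of x] show ?thesis by linarith
qed

end

text \<open>The difference \<open>F - G\<close> is constant up to an error of order
  \<open>s > 1\<close>, so its derivative at \<open>0\<close> vanishes.\<close>

lemma DERIV_zero_cong_superlinear: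
  fixes F G :: "real \<Rightarrow> real"
  assumes G: "(G has_real_derivative D) (at 0)" and s: "1 < s"
    and bd: "\<And>\<tau>. \<bar>\<tau>\<bar> \<le> 1 \<Longrightarrow> \<bar>F \<tau> - F 0 - (G \<tau> - G 0)\<bar> \<le> K * \<bar>\<tau>\<bar> powr s"
  shows "(F has_real_derivative D) (at 0)"
proof -
  have "((\<lambda>\<tau>::real. \<bar>\<tau>\<bar> powr (s - 1)) \<longlongrightarrow> \<bar>0\<bar> powr (s - 1)) (at 0)"
    by (rule tendsto_powr') (use s in \<open>auto intro!: tendsto_eq_intros\<close>)
  then have lim: "((\<lambda>\<tau>. K * \<bar>\<tau>\<bar> powr (s - 1)) \<longlongrightarrow> 0) (at 0)"
    by (intro tendsto_mult_right_zero) simp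
  have "((\<lambda>\<tau>. ((F \<tau> - G \<tau>) - (F 0 - G 0)) / \<tau>) \<longlongrightarrow> 0) (at 0)"
  proof (rule Lim_null_comparison[OF _ lim])
    have "norm (((F \<tau> - G \<tau>) - (F 0 - G 0)) / \<tau>) \<le> K * \<bar>\<tau>\<bar> powr (s - 1)"
      if "\<tau> \<noteq> 0" "\<bar>\<tau>\<bar> < 1" for \<tau>
    proof -
      have "\<bar>(F \<tau> - G \<tau>) - (F 0 - G 0)\<bar> \<le> K * \<bar>\<tau>\<bar> powr s"
        using bd[of \<tau>] that by (simp add: algebra_simps)
      also have "\<bar>\<tau>\<bar> powr s = \<bar>\<tau>\<bar> powr (s - 1) * \<bar>\<tau>\<bar>"
        using that powr_add[of "\<bar>\<tau>\<bar>" "s - 1" 1] by simp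
      finally show ?thesis using that by (simp add: field_simps)
    qed
    then show "\<forall>\<^sub>F \<tau> in at 0. norm (((F \<tau> - G \<tau>) - (F 0 - G 0)) / \<tau>) \<le> K * \<bar>\<tau>\<bar> powr (s - 1)"
      unfolding eventually_at by (intro exI[of _ 1]) (auto simp: dist_real_def)
  qed
  then have "((\<lambda>\<tau>. F \<tau> - G \<tau>) has_real_derivative 0) (at 0)"
    by (simp add: DERIV_def)
  from DERIV_add[OF this G] show ?thesis by simp
qed

subsection \<open>Hoelder continuity along dilations\<close>

text \<open>The dilation factor is written \<open>exp \<tau>\<close> so that repeating a dilation
  doubles \<open>\<tau>\<close>, as \<open>doubling_bound\<close> requires.\<close>

definition dilation_holder ::
    "real \<Rightarrow> real \<Rightarrow> ('a::real_normed_vector \<Rightarrow> real) \<Rightarrow> bool" where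
  "dilation_holder lam \<beta> w \<longleftrightarrow> (\<exists>C\<ge>0. \<forall>\<tau> x. \<bar>\<tau>\<bar> \<le> 1 \<longrightarrow>
     \<bar>w (exp \<tau> *\<^sub>R x) - w x\<bar> \<le> C * \<bar>\<tau>\<bar> powr \<beta> * weight lam x)"

context cone_system
begin

lemma Q_scaleR_iff: "0 < t \<Longrightarrow> t *\<^sub>R y \<in> Q \<longleftrightarrow> y \<in> Q"
  using Q_cone[of "t *\<^sub>R y" "1 / t"] Q_cone[of y t] by auto

text \<open>Both values are comparable to \<open>weight\<close>, which a dilation with
  \<open>\<bar>\<tau>\<bar> \<le> 1\<close> changes by a bounded factor. The ratio thus stays away
  from 0, as the expansions of negative powers demand.\<close>

lemma u_dilation_ratio:
  obtains c where "0 < c" "\<And>\<tau> x. \<bar>\<tau>\<bar> \<le> 1 \<Longrightarrow> c * u x \<le> u (exp \<tau> *\<^sub>R x)"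
proof -
  obtain c where c: "0 < c" "\<And>x. c * weight lam x \<le> u x" using u_lower by blast
  define G where "G = 1 + (LINT y|lborel. weight lam y * g y)"
  have G: "0 < G" using integral_weight_g_nonneg by (simp add: G_def)
  have uG: "u x \<le> G * weight lam x" for x
    using u_upper[of x] weight_pos[of lam x] by (simp add: G_def algebra_simps)
  show thesis
  proof
    show "0 < c / (9 powr lam * G)" using c G by simp
    fix \<tau> :: real and x :: 'x assume "\<bar>\<tau>\<bar> \<le> 1"
    then have "weight lam (exp (- \<tau>) *\<^sub>R exp \<tau> *\<^sub>R x) \<le> 9 powr lam * weight lam (exp \<tau> *\<^sub>R x)"
      using lam_pos by (intro weight_exp_le) auto
    then have "weight lam x \<le> 9 powr lam * weight lam (exp \<tau> *\<^sub>R x)"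
      by (simp add: exp_minus)
    then have "c / 9 powr lam * weight lam x \<le> c * weight lam (exp \<tau> *\<^sub>R x)"
      using c(1) by (simp add: field_simps)
    also have "\<dots> \<le> u (exp \<tau> *\<^sub>R x)" by (rule c)
    finally have *: "c / 9 powr lam * weight lam x \<le> u (exp \<tau> *\<^sub>R x)" .
    have "c / (9 powr lam * G) * u x \<le> c / (9 powr lam * G) * (G * weight lam x)"
      using c(1) G by (intro mult_left_mono uG) auto
    also have "\<dots> = c / 9 powr lam * weight lam x" using G by simp
    finally show "c / (9 powr lam * G) * u x \<le> u (exp \<tau> *\<^sub>R x)" using * by linarith
  qed
qed

lemma u_dilation_bounded: "dilation_holder lam 0 u"
proof -
  define G where "G = (LINT y|lborel. weight lam y * g y)"
  have G: "0 \<le> G" unfolding G_def by (rule integral_weight_g_nonneg)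
  show ?thesis
    unfolding dilation_holder_def
  proof (intro exI conjI allI impI)
    show "0 \<le> (9 powr lam + 1) * G" using G by (simp add: add_pos_pos less_imp_le)
    fix \<tau> :: real and x :: 'x assume \<tau>: "\<bar>\<tau>\<bar> \<le> 1"
    have "u (exp \<tau> *\<^sub>R x) \<le> weight lam (exp \<tau> *\<^sub>R x) * G" unfolding G_def by (rule u_upper)
    also have "\<dots> \<le> (9 powr lam * weight lam x) * G"
      using G \<tau> lam_pos by (intro mult_right_mono weight_exp_le) auto
    finally have 1: "u (exp \<tau> *\<^sub>R x) \<le> (9 powr lam * weight lam x) * G" .
    have 2: "u x \<le> weight lam x * G" unfolding G_def by (rule u_upper)
    have "\<bar>u (exp \<tau> *\<^sub>R x) - u x\<bar> \<le> (9 powr lam * weight lam x) * G + weight lam x * G"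
      using 1 2 u_nonneg[of x] u_nonneg[of "exp \<tau> *\<^sub>R x"] by linarith
    then show "\<bar>u (exp \<tau> *\<^sub>R x) - u x\<bar> \<le> (9 powr lam + 1) * G * \<bar>\<tau>\<bar> powr 0 * weight lam x"
      \<comment> \<open>The case \<open>\<tau> = 0\<close> is separate because
        \<open>0 powr 0 = 0\<close>; there the left-hand side vanishes too.\<close>
      by (cases "\<tau> = 0") (simp_all add: algebra_simps)
  qed
qed

text \<open>If \<open>q \<le> 1\<close>, then \<open>v powr (1 - q)\<close> is bounded below by a
  positive constant. On \<open>Q\<close> it equals \<open>v * g\<close>, which is at most a multiple
  of the integrable \<open>weight lam y * g y\<close>. Hence the cone \<open>Q\<close> would have
  finite measure.\<close>

lemma q_gt_one: "1 < q"
proof (rule ccontr)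
  assume "\<not> 1 < q"
  interpret sw: cone_system "\<lambda>y x. d x y" lam Q P q p g f by (rule swap)
  obtain c where c: "0 < c" "\<And>y. c * weight lam y \<le> v y" using sw.u_lower by blast
  define F where "F = (LINT x|lborel. weight lam x * f x)"
  define e where "e = c powr (1 - q) / F"
  have vF: "v y \<le> weight lam y * F" for y unfolding F_def by (rule sw.u_upper)
  have "0 < weight lam (0 :: 'y) * F" using vF[of 0] sw.u_pos[of 0] by linarith
  then have F: "0 < F" using weight_pos by (rule zero_less_mult_pos)
  have e: "0 < e" using c F by (simp add: e_def)
  have le: "e * indicator Q y \<le> weight lam y * g y" for y
  proof (cases "y \<in> Q")
    case True
    have "c * 1 \<le> c * weight lam y"
      using c(1) weight_ge_one[of lam y] lam_pos by (intro mult_left_mono) auto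
    then have "c \<le> v y" using c(2)[of y] by linarith
    then have "c powr (1 - q) \<le> v y powr (1 - q)"
      using c(1) \<open>\<not> 1 < q\<close> by (intro powr_mono2) auto
    also have "\<dots> = v y * g y"
      using True sw.u_pos[of y] by (simp add: g_eq powr_diff powr_minus_divide)
    also have "\<dots> \<le> weight lam y * F * g y" by (intro mult_right_mono vF) simp
    finally show ?thesis using True F by (simp add: e_def field_simps)
  next
    case False
    then show ?thesis by (simp add: g_zero)
  qed
  have [measurable]: "Q \<in> sets borel" using Q_open by simp
  have "integrable lborel (\<lambda>y. e * indicator Q y)"
  proof (rule Bochner_Integration.integrable_bound[OF integrable_weight_g])
    show "AE y in lborel. norm (e * indicator Q y) \<le> norm (weight lam y * g y)"
      using le e by (intro AE_I2) (simp add: abs_mult)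
  qed measurable
  then have int: "integrable lborel (indicator Q :: 'y \<Rightarrow> real)" using e by simp
  define J where "J = (LINT y|lborel. (indicator Q y :: real))"
  have "0 < J" unfolding J_def
    by (rule integral_pos_of_pos_on_open[OF int _ Q_open]) auto
  have "J = (LINT y|lborel. (indicator Q ((2::real) *\<^sub>R y) :: real))"
    unfolding J_def indicator_def by (simp add: Q_scaleR_iff)
  also have "\<dots> = J / 2 ^ DIM('y)"
    unfolding J_def by (rule integral_lborel_scaleR) auto
  also have "\<dots> < J / 1"
    using \<open>0 < J\<close> by (intro divide_strict_left_mono one_less_power) auto
  finally show False by simp
qed

section \<open>Dilated densities and the gain in Hoelder exponent\<close>

lemma potential_scaleR:
  assumes t: "0 < t"
  shows "integrable lborel (\<lambda>y. d x y powr lam * (t powr lam * t ^ DIM('y) * g (t *\<^sub>R y)))"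
    and "u (t *\<^sub>R x) = (LINT y|lborel. d x y powr lam * (t powr lam * t ^ DIM('y) * g (t *\<^sub>R y)))"
proof -
  define h where "h y = d (t *\<^sub>R x) y powr lam * g y" for y
  have [measurable]: "h \<in> borel_measurable borel" unfolding h_def by measurable
  have eq: "d x y powr lam * (t powr lam * t ^ DIM('y) * g (t *\<^sub>R y)) = t ^ DIM('y) * h (t *\<^sub>R y)" for y
    using t by (simp add: h_def d_scaleR powr_mult)
  have "integrable lborel h" unfolding h_def by (rule integrable_kernel_g)
  then show "integrable lborel (\<lambda>y. d x y powr lam * (t powr lam * t ^ DIM('y) * g (t *\<^sub>R y)))"
    unfolding eq using t by (simp add: integrable_lborel_scaleR)
  show "u (t *\<^sub>R x) = (LINT y|lborel. d x y powr lam * (t powr lam * t ^ DIM('y) * g (t *\<^sub>R y)))"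
    unfolding eq using t by (simp add: integral_lborel_scaleR potential_def h_def[symmetric])
qed

text \<open>The density whose potential at \<open>x\<close> is
  \<open>u (exp \<tau> *\<^sub>R x)\<close>. In the exponent, \<open>lam\<close> comes from
  homogeneity of the kernel and \<open>DIM('y)\<close> from the Jacobian.\<close>

definition dilated_g :: "real \<Rightarrow> 'y \<Rightarrow> real" where
  "dilated_g \<tau> y = exp ((lam + DIM('y)) * \<tau>) * g (exp \<tau> *\<^sub>R y)"

lemma u_exp_scaleR:
  shows integrable_kernel_dilated_g: "integrable lborel (\<lambda>y. d x y powr lam * dilated_g \<tau> y)"
    and "u (exp \<tau> *\<^sub>R x) = (LINT y|lborel. d x y powr lam * dilated_g \<tau> y)"
proof -
  have *: "exp \<tau> powr lam * exp \<tau> ^ DIM('y) * g (exp \<tau> *\<^sub>R y) = dilated_g \<tau> y" for y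
    by (simp add: dilated_g_def powr_def exp_of_nat_mult[symmetric] exp_add[symmetric] algebra_simps)
  show "integrable lborel (\<lambda>y. d x y powr lam * dilated_g \<tau> y)"
    and "u (exp \<tau> *\<^sub>R x) = (LINT y|lborel. d x y powr lam * dilated_g \<tau> y)"
    using potential_scaleR[of "exp \<tau>" x] unfolding * by auto
qed

text \<open>On \<open>Q\<close> the quotient \<open>dilated_g \<tau> y / g y\<close> is an
  exponential factor times the power \<open>- q\<close> of a ratio of values of \<open>v\<close>.
  The power is Lipschitz on that range of ratios, and the exponential differs from 1 by order
  \<open>\<bar>\<tau>\<bar>\<close>, hence by order
  \<open>\<bar>\<tau>\<bar> powr \<beta>\<close>.\<close>

lemma dilated_g_holder:
  assumes holder: "dilation_holder lam \<beta> v" and \<beta>: "0 \<le> \<beta>" "\<beta> \<le> 1"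
  obtains C where "0 \<le> C"
    "\<And>\<tau> y. \<bar>\<tau>\<bar> \<le> 1 \<Longrightarrow> \<bar>dilated_g \<tau> y - g y\<bar> \<le> C * \<bar>\<tau>\<bar> powr \<beta> * g y"
proof -
  interpret sw: cone_system "\<lambda>y x. d x y" lam Q P q p g f by (rule swap)
  obtain c where c: "0 < c" "\<And>y. c * weight lam y \<le> v y" using sw.u_lower by blast
  obtain r where r: "0 < r" "\<And>\<tau> y. \<bar>\<tau>\<bar> \<le> 1 \<Longrightarrow> r * v y \<le> v (exp \<tau> *\<^sub>R y)"
    using sw.u_dilation_ratio by blast
  obtain C where C: "0 \<le> C"
    "\<And>\<tau> y. \<bar>\<tau>\<bar> \<le> 1 \<Longrightarrow> \<bar>v (exp \<tau> *\<^sub>R y) - v y\<bar> \<le> C * \<bar>\<tau>\<bar> powr \<beta> * weight lam y"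
    using holder unfolding dilation_holder_def by blast
  obtain L where L: "0 \<le> L" "\<And>\<rho>. r \<le> \<rho> \<Longrightarrow> \<bar>\<rho> powr (- q) - 1\<bar> \<le> L * \<bar>\<rho> - 1\<bar>"
    using powr_neg_lipschitz[OF r(1) less_imp_le[OF q_pos]] by blast
  define a where "a = lam + DIM('y)"
  have a: "0 \<le> a" using lam_pos by (simp add: a_def)
  define C' where "C' = exp a * (L * (C / c)) + a * exp a"
  show thesis
  proof
    show "0 \<le> C'" using L C c a by (simp add: C'_def)
    fix \<tau> :: real and y assume \<tau>: "\<bar>\<tau>\<bar> \<le> 1"
    show "\<bar>dilated_g \<tau> y - g y\<bar> \<le> C' * \<bar>\<tau>\<bar> powr \<beta> * g y"
    proof (cases "y \<in> Q")
      case False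
      then show ?thesis by (simp add: dilated_g_def g_zero Q_scaleR_iff)
    next
      case True
      define \<rho> where "\<rho> = v (exp \<tau> *\<^sub>R y) / v y"
      define E where "E = exp (a * \<tau>)"
      have vy: "0 < v y" "0 < v (exp \<tau> *\<^sub>R y)" using sw.u_pos by auto
      have \<rho>: "r \<le> \<rho>" using r(2)[OF \<tau>, of y] vy by (simp add: \<rho>_def field_simps)
      have "g (exp \<tau> *\<^sub>R y) = \<rho> powr (- q) * g y"
        using True vy by (simp add: g_eq Q_scaleR_iff \<rho>_def powr_divide)
      then have *: "dilated_g \<tau> y = E * \<rho> powr (- q) * g y"
        by (simp add: dilated_g_def E_def a_def)
      have "\<bar>\<rho> - 1\<bar> = \<bar>v (exp \<tau> *\<^sub>R y) - v y\<bar> / v y"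
      proof -
        have "\<rho> - 1 = (v (exp \<tau> *\<^sub>R y) - v y) / v y"
          using vy by (simp add: \<rho>_def diff_divide_distrib)
        then show ?thesis using vy by simp
      qed
      also have "\<dots> \<le> C * \<bar>\<tau>\<bar> powr \<beta> * weight lam y / (c * weight lam y)"
        using C(2)[OF \<tau>] c weight_pos[of lam y] C(1) by (intro frac_le) auto
      finally have \<rho>1: "\<bar>\<rho> - 1\<bar> \<le> C / c * \<bar>\<tau>\<bar> powr \<beta>"
        using weight_pos[of lam y] by simp
      have "\<bar>\<rho> powr (- q) - 1\<bar> \<le> L * (C / c * \<bar>\<tau>\<bar> powr \<beta>)"
        using L(2)[OF \<rho>] mult_left_mono[OF \<rho>1 L(1)] by linarith
      moreover have aE: "\<bar>a * \<tau>\<bar> \<le> a" using a \<tau> by (simp add: abs_mult mult_left_le)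
      then have "E \<le> exp a" by (simp add: E_def)
      ultimately have 1: "E * \<bar>\<rho> powr (- q) - 1\<bar> \<le> exp a * (L * (C / c * \<bar>\<tau>\<bar> powr \<beta>))"
        by (intro mult_mono) auto
      have "\<bar>E - 1\<bar> \<le> \<bar>a * \<tau>\<bar> * exp \<bar>a * \<tau>\<bar>" unfolding E_def by (rule abs_exp_minus_one_le)
      also have "\<dots> \<le> \<bar>a * \<tau>\<bar> * exp a" using aE by (intro mult_left_mono) auto
      also have "\<dots> = a * exp a * \<bar>\<tau>\<bar>" using a by (simp add: abs_mult)
      also have "\<dots> \<le> a * exp a * \<bar>\<tau>\<bar> powr \<beta>"
        using a \<beta> \<tau> powr_mono'[of \<beta> 1 "\<bar>\<tau>\<bar>"] by (intro mult_left_mono) (cases "\<tau> = 0"; auto)+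
      finally have 2: "\<bar>E - 1\<bar> \<le> a * exp a * \<bar>\<tau>\<bar> powr \<beta>" .
      have "\<bar>E * \<rho> powr (- q) - 1\<bar> = \<bar>E * (\<rho> powr (- q) - 1) + (E - 1)\<bar>"
        by (simp add: algebra_simps)
      also have "\<dots> \<le> \<bar>E * (\<rho> powr (- q) - 1)\<bar> + \<bar>E - 1\<bar>" by (rule abs_triangle_ineq)
      also have "\<bar>E * (\<rho> powr (- q) - 1)\<bar> = E * \<bar>\<rho> powr (- q) - 1\<bar>"
        by (simp add: abs_mult E_def)
      finally have "\<bar>E * \<rho> powr (- q) - 1\<bar> \<le> C' * \<bar>\<tau>\<bar> powr \<beta>"
        using 1 2 by (simp add: C'_def algebra_simps)
      then have "\<bar>E * \<rho> powr (- q) - 1\<bar> * g y \<le> C' * \<bar>\<tau>\<bar> powr \<beta> * g y"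
        by (intro mult_right_mono) auto
      moreover have "dilated_g \<tau> y - g y = (E * \<rho> powr (- q) - 1) * g y"
        unfolding * by (simp add: left_diff_distrib)
      ultimately show ?thesis by (simp add: abs_mult)
    qed
  qed
qed

text \<open>The second difference of \<open>u\<close> is the integral of a kernel increment of order
  \<open>\<alpha>\<close> times a density increment of order \<open>\<beta>\<close>.
  \<open>doubling_bound\<close> passes to the first difference, which is why
  \<open>\<alpha> + \<beta> < 1\<close> is required.\<close>

lemma u_dilation_holder_step:
  assumes holder: "dilation_holder lam \<beta> v" and \<beta>: "0 \<le> \<beta>"
    and \<alpha>: "0 < \<alpha>" "\<alpha> \<le> lam" "\<alpha> + \<beta> < 1"
  shows "dilation_holder lam (\<alpha> + \<beta>) u"
proof -
  define \<gamma> where "\<gamma> = \<alpha> + \<beta>"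
  obtain C where C: "0 \<le> C"
    "\<And>\<tau> y. \<bar>\<tau>\<bar> \<le> 1 \<Longrightarrow> \<bar>dilated_g \<tau> y - g y\<bar> \<le> C * \<bar>\<tau>\<bar> powr \<beta> * g y"
    using dilated_g_holder[OF holder \<beta>] \<alpha> by auto
  define G where "G = (LINT y|lborel. weight lam y * g y)"
  have G: "0 \<le> G" unfolding G_def by (rule integral_weight_g_nonneg)
  define M where "M = max 1 lam * 3 powr lam"
  have M: "0 \<le> M" by (simp add: M_def)
  have second: "\<bar>u (exp (2 * \<tau>) *\<^sub>R x) - 2 * u (exp \<tau> *\<^sub>R x) + u x\<bar>
      \<le> M * C * G * weight lam x * \<bar>\<tau>\<bar> powr \<gamma>" if \<tau>: "\<bar>\<tau>\<bar> \<le> 1" for \<tau> x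
  proof -
    define k where "k y = d x y powr lam" for y
    define k' where "k' y = d (exp \<tau> *\<^sub>R x) y powr lam" for y
    define h where "h y = (k' y - k y) * (dilated_g \<tau> y - g y)" for y
    have h: "h = (\<lambda>y. (k' y * dilated_g \<tau> y - k y * dilated_g \<tau> y) - (k' y * g y - k y * g y))"
      by (auto simp: h_def algebra_simps)
    note ints = integrable_kernel_g[of x, folded k_def]
      integrable_kernel_g[of "exp \<tau> *\<^sub>R x", folded k'_def]
      integrable_kernel_dilated_g[of x \<tau>, folded k_def]
      integrable_kernel_dilated_g[of "exp \<tau> *\<^sub>R x" \<tau>, folded k'_def]
    have int: "integrable lborel h"
      unfolding h by (intro Bochner_Integration.integrable_diff ints)
    \<comment> \<open>A dilation can be put on the kernel or on the density. The value at
      \<open>2 * \<tau>\<close> uses both, and the two copies of the value at \<open>\<tau>\<close>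
      use one each, so the four integrals combine into a product of differences.\<close>
    have "u (exp (2 * \<tau>) *\<^sub>R x) = (LINT y|lborel. k' y * dilated_g \<tau> y)"
      using u_exp_scaleR(2)[of \<tau> "exp \<tau> *\<^sub>R x"] by (simp add: k'_def exp_add[symmetric])
    moreover have "u (exp \<tau> *\<^sub>R x) = (LINT y|lborel. k y * dilated_g \<tau> y)"
      using u_exp_scaleR(2)[of \<tau> x] by (simp add: k_def)
    moreover have "u (exp \<tau> *\<^sub>R x) = (LINT y|lborel. k' y * g y)" "u x = (LINT y|lborel. k y * g y)"
      by (simp_all add: potential_def k_def k'_def)
    ultimately have "u (exp (2 * \<tau>) *\<^sub>R x) - 2 * u (exp \<tau> *\<^sub>R x) + u x = (LINT y|lborel. h y)"
      unfolding h using ints by (simp add: Bochner_Integration.integral_diff)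
    also have "\<bar>\<dots>\<bar> \<le> (LINT y|lborel. \<bar>h y\<bar>)" by (rule integral_abs_bound)
    also have "\<dots> \<le> (LINT y|lborel. M * C * weight lam x * \<bar>\<tau>\<bar> powr \<gamma> * (weight lam y * g y))"
    proof (intro integral_mono integrable_mult_right integrable_weight_g integrable_abs int)
      fix y
      have "\<bar>h y\<bar> = \<bar>k' y - k y\<bar> * \<bar>dilated_g \<tau> y - g y\<bar>" by (simp add: h_def abs_mult)
      also have "\<dots> \<le> (M * \<bar>\<tau>\<bar> powr \<alpha> * (weight lam x * weight lam y)) * (C * \<bar>\<tau>\<bar> powr \<beta> * g y)"
        unfolding k_def k'_def M_def
        using \<alpha> \<beta> C(2)[OF \<tau>] \<tau> by (intro mult_mono kernel_holder) (auto simp: less_imp_le[OF weight_pos])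
      finally show "\<bar>h y\<bar> \<le> M * C * weight lam x * \<bar>\<tau>\<bar> powr \<gamma> * (weight lam y * g y)"
        by (simp add: \<gamma>_def powr_add mult_ac)
    qed
    also have "\<dots> = M * C * G * weight lam x * \<bar>\<tau>\<bar> powr \<gamma>" by (simp add: G_def)
    finally show ?thesis .
  qed
  obtain B where B: "0 \<le> B"
    "\<And>\<tau> x. \<bar>\<tau>\<bar> \<le> 1 \<Longrightarrow> \<bar>u (exp \<tau> *\<^sub>R x) - u x\<bar> \<le> B * \<bar>\<tau>\<bar> powr 0 * weight lam x"
    using u_dilation_bounded unfolding dilation_holder_def by blast
  define N where "N = B + M * C * G"
  have N: "0 \<le> N" "B \<le> N" "M * C * G \<le> N" using B M C G by (auto simp: N_def)
  have "\<bar>u (exp \<tau> *\<^sub>R x) - u x\<bar> \<le> 2 / (2 - 2 powr \<gamma>) * (N * weight lam x) * \<bar>\<tau>\<bar> powr \<gamma>"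
    if "\<bar>\<tau>\<bar> \<le> 1" for \<tau> x
  proof (rule doubling_bound[where \<delta> = "\<lambda>\<tau>. u (exp \<tau> *\<^sub>R x) - u x"])
    show "0 \<le> \<gamma>" "\<gamma> < 1" using \<alpha> \<beta> by (auto simp: \<gamma>_def)
    show "0 \<le> N * weight lam x" using N weight_pos[of lam x] by simp
    show "\<bar>\<tau>\<bar> \<le> 1" by fact
    fix \<tau> :: real assume \<tau>: "\<bar>\<tau>\<bar> \<le> 1"
    have "B * \<bar>\<tau>\<bar> powr 0 * weight lam x \<le> N * 1 * weight lam x"
      using N B weight_pos[of lam x] by (intro mult_right_mono mult_mono) auto
    then show "\<bar>u (exp \<tau> *\<^sub>R x) - u x\<bar> \<le> N * weight lam x"
      using B(2)[OF \<tau>, of x] by linarith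
    have "M * C * G * weight lam x * \<bar>\<tau>\<bar> powr \<gamma> \<le> N * weight lam x * \<bar>\<tau>\<bar> powr \<gamma>"
      using N weight_pos[of lam x] by (intro mult_right_mono) auto
    moreover have "u (exp (2 * \<tau>) *\<^sub>R x) - u x - 2 * (u (exp \<tau> *\<^sub>R x) - u x)
        = u (exp (2 * \<tau>) *\<^sub>R x) - 2 * u (exp \<tau> *\<^sub>R x) + u x" by simp
    ultimately show "\<bar>u (exp (2 * \<tau>) *\<^sub>R x) - u x - 2 * (u (exp \<tau> *\<^sub>R x) - u x)\<bar>
        \<le> N * weight lam x * \<bar>\<tau>\<bar> powr \<gamma>"
      using second[OF \<tau>, of x] by linarith
  qed
  moreover have "2 powr \<gamma> < 2 powr (1::real)" using \<alpha> by (intro powr_less_mono) (auto simp: \<gamma>_def)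
  then have "0 \<le> 2 / (2 - 2 powr \<gamma>) * N" using N by simp
  ultimately show ?thesis
    unfolding dilation_holder_def \<gamma>_def[symmetric]
    by (intro exI[of _ "2 / (2 - 2 powr \<gamma>) * N"]) (simp add: mult_ac)
qed

text \<open>Starting from boundedness, each round adds \<open>\<alpha>\<close> to the exponents of
  \<open>u\<close> and \<open>v\<close> simultaneously, since the step for one needs the previous
  exponent of the other.\<close>

lemma dilation_holder_exceeds_half:
  obtains \<beta> where "1 / 2 < \<beta>" "dilation_holder lam \<beta> u"
proof -
  interpret sw: cone_system "\<lambda>y x. d x y" lam Q P q p g f by (rule swap)
  \<comment> \<open>With \<open>\<alpha> \<le> 2 / 5\<close> the first multiple of
    \<open>\<alpha>\<close> above \<open>1 / 2\<close> is at most \<open>9 / 10\<close>, so the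
    iteration passes one half before reaching 1.\<close>
  define \<alpha> where "\<alpha> = min lam (2 / 5)"
  have \<alpha>: "0 < \<alpha>" "\<alpha> \<le> lam" "\<alpha> \<le> 2 / 5" using lam_pos by (auto simp: \<alpha>_def)
  have step: "dilation_holder lam (k * \<alpha>) u \<and> dilation_holder lam (k * \<alpha>) v"
    if "k * \<alpha> < 1" for k :: nat
    using that
  proof (induction k)
    case 0
    then show ?case using u_dilation_bounded sw.u_dilation_bounded by simp
  next
    case (Suc k)
    have eq: "real (Suc k) * \<alpha> = \<alpha> + k * \<alpha>" by (simp add: algebra_simps)
    then have "dilation_holder lam (k * \<alpha>) u" "dilation_holder lam (k * \<alpha>) v"
      using Suc \<alpha> by auto
    then show ?case
      unfolding eq using Suc.prems \<alpha> eq
      by (intro conjI u_dilation_holder_step sw.u_dilation_holder_step) auto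
  qed
  define k where "k = (LEAST k::nat. 1 / 2 < k * \<alpha>)"
  have ex: "\<exists>k::nat. 1 / 2 < k * \<alpha>" using \<alpha>(1) by (rule reals_Archimedean3[rule_format])
  then have k: "1 / 2 < k * \<alpha>" unfolding k_def by (rule LeastI_ex)
  then obtain j where j: "k = Suc j" by (cases k) auto
  then have "\<not> 1 / 2 < j * \<alpha>" unfolding k_def by (intro not_less_Least) simp
  then have "k * \<alpha> < 1" using \<alpha> by (simp add: j algebra_simps)
  with step[of k] k show thesis by (intro that[of "k * \<alpha>"]) auto
qed

subsection \<open>Dilation integrals and the balance of exponents\<close>

lemma integrable_u_f: "integrable lborel (\<lambda>x. u (exp \<tau> *\<^sub>R x) * f x)"
proof (rule Bochner_Integration.integrable_bound)
  interpret sw: cone_system "\<lambda>y x. d x y" lam Q P q p g f by (rule swap)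
  define G where "G = (LINT y|lborel. weight lam y * g y)"
  have G: "0 \<le> G" unfolding G_def by (rule integral_weight_g_nonneg)
  show "integrable lborel (\<lambda>x. max 1 (exp \<tau>) powr lam * G * (weight lam x * f x))"
    by (intro integrable_mult_right sw.integrable_weight_g)
  show "AE x in lborel. norm (u (exp \<tau> *\<^sub>R x) * f x)
      \<le> norm (max 1 (exp \<tau>) powr lam * G * (weight lam x * f x))"
  proof (rule AE_I2)
    fix x :: 'x
    have "u (exp \<tau> *\<^sub>R x) \<le> weight lam (exp \<tau> *\<^sub>R x) * G" unfolding G_def by (rule u_upper)
    also have "\<dots> \<le> max 1 (exp \<tau>) powr lam * weight lam x * G"
      using G lam_pos by (intro mult_right_mono weight_scaleR_le) auto
    finally have "u (exp \<tau> *\<^sub>R x) * f x \<le> max 1 (exp \<tau>) powr lam * weight lam x * G * f x"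
      by (intro mult_right_mono) auto
    then show "norm (u (exp \<tau> *\<^sub>R x) * f x)
        \<le> norm (max 1 (exp \<tau>) powr lam * G * (weight lam x * f x))"
      using G u_nonneg[of "exp \<tau> *\<^sub>R x"] by (simp add: abs_mult mult_ac)
  qed
qed measurable

lemma integral_u_f_pos: "0 < (LINT x|lborel. u x * f x)"
  using integrable_u_f[of 0] u_nonneg f_pos u_pos
  by (intro integral_pos_of_pos_on_open[OF _ _ P_open]) auto

text \<open>Fubini, combined with \<open>d (exp \<tau> *\<^sub>R x) y = exp \<tau> * d x (exp (-
  \<tau>) *\<^sub>R y)\<close>.\<close>

lemma integral_dilated_u_duality:
  "(LINT x|lborel. u (exp \<tau> *\<^sub>R x) * f x)
    = exp (lam * \<tau>) * (LINT y|lborel. v (exp (- \<tau>) *\<^sub>R y) * g y)"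
proof -
  define F where "F x y = d (exp \<tau> *\<^sub>R x) y powr lam * g y * f x" for x y
  have F0: "0 \<le> F x y" for x y by (simp add: F_def)
  have Fx: "(LINT y|lborel. F x y) = u (exp \<tau> *\<^sub>R x) * f x" for x
    by (simp add: F_def potential_def)
  have "integrable (lborel \<Otimes>\<^sub>M lborel) (\<lambda>(x, y). F x y)"
  proof (rule lborel_pair.Fubini_integrable)
    show "(\<lambda>(x, y). F x y) \<in> borel_measurable (lborel \<Otimes>\<^sub>M lborel)"
      unfolding F_def by measurable
    show "integrable lborel (\<lambda>x. LINT y|lborel. norm (case (x, y) of (x, y) \<Rightarrow> F x y))"
      using integrable_u_f[of \<tau>] by (simp add: F0 Fx)
    show "AE x in lborel. integrable lborel (\<lambda>y. case (x, y) of (x, y) \<Rightarrow> F x y)"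
      unfolding F_def split_conv by (intro AE_I2 integrable_mult_left integrable_kernel_g)
  qed
  then have swapped: "(LINT x|lborel. u (exp \<tau> *\<^sub>R x) * f x) = (LINT y|lborel. LINT x|lborel. F x y)"
    unfolding Fx[symmetric] by (rule lborel_pair.Fubini_integral[symmetric])
  have inner: "(LINT x|lborel. F x y) = exp (lam * \<tau>) * (v (exp (- \<tau>) *\<^sub>R y) * g y)" for y
  proof -
    have "F x y = exp (lam * \<tau>) * g y * (d x (exp (- \<tau>) *\<^sub>R y) powr lam * f x)" for x
    proof -
      have "d (exp \<tau> *\<^sub>R x) y = exp \<tau> * d x (exp (- \<tau>) *\<^sub>R y)"
        using d_scaleR[of "exp \<tau>" x "exp (- \<tau>) *\<^sub>R y"] by (simp add: exp_add[symmetric])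
      then show ?thesis by (simp add: F_def powr_mult) (simp add: powr_def)
    qed
    then show ?thesis by (simp add: potential_def)
  qed
  show ?thesis unfolding swapped inner by simp
qed

text \<open>The integral of \<open>\<phi> = u * f\<close> over dilated arguments is known exactly by
  change of variables. Since \<open>\<phi>\<close> is \<open>u powr (1 - p)\<close> on
  \<open>P\<close>, its first-order expansion expresses the same quantity through
  \<open>A \<tau>\<close>, with an error of order \<open>2 * \<beta> > 1\<close>.\<close>

lemma DERIV_integral_dilated_u:
  "((\<lambda>\<tau>. LINT x|lborel. u (exp \<tau> *\<^sub>R x) * f x) has_real_derivative
    DIM('x) / (p - 1) * (LINT x|lborel. u x * f x)) (at 0)"
proof -
  interpret sw: cone_system "\<lambda>y x. d x y" lam Q P q p g f by (rule swap)
  have p: "1 < p" by (rule sw.q_gt_one)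
  define n where "n = DIM('x)"
  define A where "A \<tau> = (LINT x|lborel. u (exp \<tau> *\<^sub>R x) * f x)" for \<tau>
  define I where "I = (LINT x|lborel. u x * f x)"
  define \<phi> where "\<phi> x = u x * f x" for x
  have \<phi>_meas [measurable]: "\<phi> \<in> borel_measurable borel" unfolding \<phi>_def by measurable
  have int\<phi>: "integrable lborel \<phi>" using integrable_u_f[of 0] by (simp add: \<phi>_def[abs_def])
  have int\<phi>': "integrable lborel (\<lambda>x. \<phi> (exp \<tau> *\<^sub>R x))" for \<tau>
    using int\<phi> by (simp add: integrable_lborel_scaleR)
  have A0: "A 0 = I" by (simp add: A_def I_def)
  have I\<phi>: "I = (LINT x|lborel. \<phi> x)" by (simp add: I_def \<phi>_def)
  obtain \<beta> where \<beta>: "1 / 2 < \<beta>" "dilation_holder lam \<beta> u"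
    using dilation_holder_exceeds_half by blast
  obtain C where C: "0 \<le> C"
    "\<And>\<tau> x. \<bar>\<tau>\<bar> \<le> 1 \<Longrightarrow> \<bar>u (exp \<tau> *\<^sub>R x) - u x\<bar> \<le> C * \<bar>\<tau>\<bar> powr \<beta> * weight lam x"
    using \<beta>(2) unfolding dilation_holder_def by blast
  obtain c where c: "0 < c" "\<And>x. c * weight lam x \<le> u x" using u_lower by blast
  obtain r where r: "0 < r" "\<And>\<tau> x. \<bar>\<tau>\<bar> \<le> 1 \<Longrightarrow> r * u x \<le> u (exp \<tau> *\<^sub>R x)"
    using u_dilation_ratio by blast
  obtain L where L: "0 \<le> L"
    "\<And>\<rho>. r \<le> \<rho> \<Longrightarrow> \<bar>\<rho> powr (1 - p) - 1 - (1 - p) * (\<rho> - 1)\<bar> \<le> L * (\<rho> - 1)\<^sup>2"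
    using powr_taylor_bound[OF r(1) less_imp_le[OF p_pos]] by blast
  define K where "K = L * (C / c)\<^sup>2"
  \<comment> \<open>On \<open>P\<close>, dividing by \<open>\<phi> x\<close> leaves the Taylor
    remainder at the ratio \<open>\<rho>\<close>, whose distance to 1 is of order
    \<open>\<bar>\<tau>\<bar> powr \<beta>\<close>. Off the cone \<open>P\<close> everything
    vanishes.\<close>
  have pointwise: "\<bar>\<phi> (exp \<tau> *\<^sub>R x) - \<phi> x - (1 - p) * (u (exp \<tau> *\<^sub>R x) * f x - \<phi> x)\<bar>
      \<le> K * \<bar>\<tau>\<bar> powr (2 * \<beta>) * \<phi> x" if \<tau>: "\<bar>\<tau>\<bar> \<le> 1" for \<tau> x
  proof (cases "x \<in> P")
    case False
    then show ?thesis by (simp add: \<phi>_def f_zero sw.Q_scaleR_iff)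
  next
    case True
    define \<rho> where "\<rho> = u (exp \<tau> *\<^sub>R x) / u x"
    have ux: "0 < u x" "0 < u (exp \<tau> *\<^sub>R x)" using u_pos by auto
    have \<rho>: "r \<le> \<rho>" using r(2)[OF \<tau>, of x] ux by (simp add: \<rho>_def field_simps)
    have \<rho>0: "0 < \<rho>" using ux by (simp add: \<rho>_def)
    have u\<rho>: "u (exp \<tau> *\<^sub>R x) = \<rho> * u x" using ux by (simp add: \<rho>_def)
    have fx: "f x = u x powr (- p)" using True by (rule f_eq)
    have f\<rho>: "f (exp \<tau> *\<^sub>R x) = \<rho> powr (- p) * f x"
      using True ux \<rho>0 by (simp add: f_eq sw.Q_scaleR_iff u\<rho> powr_mult)
    have \<rho>p: "\<rho> powr (1 - p) = \<rho> * \<rho> powr (- p)"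
      using powr_add[of \<rho> 1 "- p"] \<rho>0 by simp
    have eq: "\<phi> (exp \<tau> *\<^sub>R x) - \<phi> x - (1 - p) * (u (exp \<tau> *\<^sub>R x) * f x - \<phi> x)
        = (\<rho> powr (1 - p) - 1 - (1 - p) * (\<rho> - 1)) * \<phi> x"
      unfolding \<phi>_def f\<rho> \<rho>p unfolding u\<rho> by (simp add: algebra_simps)
    have \<phi>0: "0 \<le> \<phi> x" using u_nonneg by (simp add: \<phi>_def)
    have "\<bar>\<rho> - 1\<bar> = \<bar>u (exp \<tau> *\<^sub>R x) - u x\<bar> / u x"
    proof -
      have "\<rho> - 1 = (u (exp \<tau> *\<^sub>R x) - u x) / u x"
        using ux by (simp add: \<rho>_def diff_divide_distrib)
      then show ?thesis using ux by simp
    qed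
    also have "\<dots> \<le> C * \<bar>\<tau>\<bar> powr \<beta> * weight lam x / (c * weight lam x)"
      using C(2)[OF \<tau>] c weight_pos[of lam x] C(1) by (intro frac_le) auto
    finally have \<rho>1: "\<bar>\<rho> - 1\<bar> \<le> C / c * \<bar>\<tau>\<bar> powr \<beta>"
      using weight_pos[of lam x] by simp
    have "(\<rho> - 1)\<^sup>2 \<le> (C / c * \<bar>\<tau>\<bar> powr \<beta>)\<^sup>2"
      using power_mono[OF \<rho>1, of 2] by simp
    also have "\<dots> = (C / c)\<^sup>2 * \<bar>\<tau>\<bar> powr (2 * \<beta>)"
      unfolding power_mult_distrib by (simp add: power2_eq_square powr_add[symmetric])
    finally have "L * (\<rho> - 1)\<^sup>2 \<le> K * \<bar>\<tau>\<bar> powr (2 * \<beta>)"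
      using mult_left_mono[OF _ L(1)] by (fastforce simp: K_def mult.assoc)
    then have "\<bar>\<rho> powr (1 - p) - 1 - (1 - p) * (\<rho> - 1)\<bar> \<le> K * \<bar>\<tau>\<bar> powr (2 * \<beta>)"
      using L(2)[OF \<rho>] by linarith
    then have "\<bar>\<rho> powr (1 - p) - 1 - (1 - p) * (\<rho> - 1)\<bar> * \<phi> x \<le> K * \<bar>\<tau>\<bar> powr (2 * \<beta>) * \<phi> x"
      using \<phi>0 by (rule mult_right_mono)
    then show ?thesis unfolding eq using \<phi>0 by (simp add: abs_mult)
  qed
  have bound: "\<bar>exp (- (n * \<tau>)) * I - I - (1 - p) * (A \<tau> - I)\<bar> \<le> K * I * \<bar>\<tau>\<bar> powr (2 * \<beta>)"
    if \<tau>: "\<bar>\<tau>\<bar> \<le> 1" for \<tau> :: real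
  proof -
    define h where "h x = \<phi> (exp \<tau> *\<^sub>R x) - \<phi> x - (1 - p) * (u (exp \<tau> *\<^sub>R x) * f x - \<phi> x)" for x
    have int: "integrable lborel h"
      unfolding h_def by (intro Bochner_Integration.integrable_diff integrable_mult_right int\<phi> int\<phi>' integrable_u_f)
    have "(LINT x|lborel. \<phi> (exp \<tau> *\<^sub>R x)) = exp (- (n * \<tau>)) * I"
      by (simp add: integral_lborel_scaleR I\<phi> n_def exp_minus exp_of_nat_mult divide_simps)
    then have "exp (- (n * \<tau>)) * I - I - (1 - p) * (A \<tau> - I) = (LINT x|lborel. h x)"
      unfolding h_def A_def I\<phi> using int\<phi> int\<phi>' integrable_u_f
      by (simp add: Bochner_Integration.integral_diff)
    also have "\<bar>\<dots>\<bar> \<le> (LINT x|lborel. \<bar>h x\<bar>)" by (rule integral_abs_bound)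
    also have "\<dots> \<le> (LINT x|lborel. K * \<bar>\<tau>\<bar> powr (2 * \<beta>) * \<phi> x)"
      using pointwise[OF \<tau>]
      by (intro integral_mono integrable_abs int integrable_mult_right int\<phi>) (simp add: h_def)
    also have "\<dots> = K * I * \<bar>\<tau>\<bar> powr (2 * \<beta>)" by (simp add: I\<phi>)
    finally show ?thesis .
  qed
  \<comment> \<open>Dropping the error in \<open>bound\<close> and solving for
    \<open>A \<tau> - I\<close> gives \<open>G \<tau>\<close>.\<close>
  define G where "G \<tau> = (I - exp (- (n * \<tau>)) * I) / (p - 1)" for \<tau> :: real
  have "(A has_real_derivative n / (p - 1) * I) (at 0)"
  proof (rule DERIV_zero_cong_superlinear)
    show "(G has_real_derivative n / (p - 1) * I) (at 0)"
      unfolding G_def using p by (auto intro!: derivative_eq_intros)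
    show "1 < 2 * \<beta>" using \<beta> by simp
    fix \<tau> :: real assume \<tau>: "\<bar>\<tau>\<bar> \<le> 1"
    have "A \<tau> - A 0 - (G \<tau> - G 0)
        = (exp (- (n * \<tau>)) * I - I - (1 - p) * (A \<tau> - I)) / (p - 1)"
      using p by (simp add: A0 G_def field_simps)
    also have "\<bar>\<dots>\<bar> \<le> K * I * \<bar>\<tau>\<bar> powr (2 * \<beta>) / (p - 1)"
      using bound[OF \<tau>] p by (simp add: divide_right_mono)
    finally show "\<bar>A \<tau> - A 0 - (G \<tau> - G 0)\<bar> \<le> K * I / (p - 1) * \<bar>\<tau>\<bar> powr (2 * \<beta>)" by simp
  qed
  then show ?thesis unfolding A_def[abs_def] I_def n_def .
qed

text \<open>Differentiating the duality at \<open>0\<close> gives an identity in which every term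
  carries the factor \<open>A 0 = B 0\<close>; this factor is positive and cancels.\<close>

theorem balance: "DIM('x) / (p - 1) + DIM('y) / (q - 1) = lam"
proof -
  interpret sw: cone_system "\<lambda>y x. d x y" lam Q P q p g f by (rule swap)
  define A where "A \<tau> = (LINT x|lborel. u (exp \<tau> *\<^sub>R x) * f x)" for \<tau>
  define B where "B \<tau> = (LINT y|lborel. v (exp \<tau> *\<^sub>R y) * g y)" for \<tau>
  have AB: "A = (\<lambda>\<tau>. exp (lam * \<tau>) * B (- \<tau>))"
    by (simp add: fun_eq_iff A_def B_def integral_dilated_u_duality)
  have A': "(A has_real_derivative DIM('x) / (p - 1) * A 0) (at 0)"
    using DERIV_integral_dilated_u by (simp add: A_def[abs_def])
  have B': "(B has_real_derivative DIM('y) / (q - 1) * B 0) (at 0)"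
    using sw.DERIV_integral_dilated_u by (simp add: B_def[abs_def])
  have "((\<lambda>\<tau>. B (- \<tau>)) has_real_derivative DIM('y) / (q - 1) * B 0 * - 1) (at 0)"
    using B' by (intro DERIV_chain2[where f = B and g = uminus]) (auto intro!: derivative_eq_intros)
  then have "(A has_real_derivative lam * B 0 - DIM('y) / (q - 1) * B 0) (at 0)"
    unfolding AB by (auto intro!: derivative_eq_intros)
  with A' have "DIM('x) / (p - 1) * A 0 = lam * B 0 - DIM('y) / (q - 1) * B 0"
    by (rule DERIV_unique)
  moreover have "A 0 = B 0" by (simp add: AB)
  moreover have "0 < A 0" using integral_u_f_pos by (simp add: A_def)
  ultimately have "(DIM('x) / (p - 1) + DIM('y) / (q - 1)) * A 0 = lam * A 0"
    by (simp add: algebra_simps)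
  with \<open>0 < A 0\<close> show ?thesis by simp
qed

end

subsection \<open>The half-space system\<close>

lemma C1_on_imp_continuous_on:
  assumes "C1_on S w"
  shows "continuous_on S w"
proof -
  obtain w' :: "'a \<Rightarrow> 'a \<Rightarrow>\<^sub>L real"
    where "\<And>x. x \<in> S \<Longrightarrow> (w has_derivative blinfun_apply (w' x)) (at x)"
    using assms unfolding C1_on_def by blast
  then show ?thesis
    by (intro continuous_at_imp_continuous_on) (blast intro: has_derivative_continuous)
qed

lemma bdist_kernel:
  assumes "0 < lam"
  shows "homogeneous_kernel (bdist :: 'a::euclidean_space \<Rightarrow> 'a \<times> real \<Rightarrow> real) lam"
proof
  fix t :: real and x x' :: 'a and y y' :: "'a \<times> real"
  show "bdist (t *\<^sub>R x) (t *\<^sub>R y) = t * bdist x y" if "0 < t"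
  proof -
    have "(t *\<^sub>R x, 0) - t *\<^sub>R y = t *\<^sub>R ((x, 0) - y)" by (simp add: prod_eq_iff algebra_simps)
    then show ?thesis using that by (simp add: bdist_def)
  qed
  have "((x, 0) - y) - ((x', 0) - y) = (x - x', 0)" by simp
  then have "norm (((x, 0) - y) - ((x', 0) - y)) = norm (x - x')"
    by (simp add: norm_Pair)
  then show "\<bar>bdist x y - bdist x' y\<bar> \<le> norm (x - x')"
    unfolding bdist_def using norm_triangle_ineq3 by metis
  have "norm (((x, 0) - y) - ((x, 0) - y')) = norm (y - y')"
    by (simp add: norm_minus_commute)
  then show "\<bar>bdist x y - bdist x y'\<bar> \<le> norm (y - y')"
    unfolding bdist_def using norm_triangle_ineq3 by metis
  show "bdist 0 y = norm y" by (simp add: bdist_def zero_prod_def[symmetric])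
  show "bdist x 0 = norm x" by (simp add: bdist_def norm_Pair)
qed (use assms in simp)

lemma bdist_pos: "y \<in> half_space \<Longrightarrow> 0 < bdist x y"
  by (auto simp: bdist_def half_space_def prod_eq_iff)

lemma open_half_space: "open half_space"
  unfolding half_space_def by (intro open_Collect_less continuous_intros)

section \<open>Positivity of solutions and passage from extended to real integrals\<close>

lemma neg_powr_nonzero: "neg_powr t p \<noteq> 0"
  by (simp add: neg_powr_def)

lemma neg_powr_pos: "0 < t \<Longrightarrow> neg_powr t p = ennreal (t powr (- p))"
  by (simp add: neg_powr_def inverse_ennreal powr_minus)

lemma neg_powr_measurable [measurable]:
  "w \<in> borel_measurable M \<Longrightarrow> (\<lambda>x. neg_powr (w x) p) \<in> borel_measurable M"
  unfolding neg_powr_def by measurable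

lemma nn_integral_pos_of_nonzero_on_open:
  fixes h :: "'a::euclidean_space \<Rightarrow> ennreal"
  assumes [measurable]: "h \<in> borel_measurable lborel"
    and S: "open S" "S \<noteq> {}" "\<And>x. x \<in> S \<Longrightarrow> h x \<noteq> 0"
  shows "(\<integral>\<^sup>+x. h x \<partial>lborel) \<noteq> 0"
proof
  assume "(\<integral>\<^sup>+x. h x \<partial>lborel) = 0"
  then have "AE x in lborel. h x = 0" by (simp add: nn_integral_0_iff_AE)
  then have "AE x in lborel. x \<notin> S" by eventually_elim (use S(3) in blast)
  with not_AE_notin_open S(1,2) show False by blast
qed

text \<open>In both equations the integrand is nonzero on a nonempty open set, because
  \<open>neg_powr\<close> never vanishes and \<open>bdist\<close> is positive on the half-space. So
  \<open>u\<close> and \<open>v\<close> are positive, \<open>neg_powr\<close> becomes a real power,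
  and the finite extended integrals become Bochner integrals.\<close>

lemma solution_cone_system:
  fixes u :: "'a::euclidean_space \<Rightarrow> real" and v :: "'a \<times> real \<Rightarrow> real"
  assumes sol: "nonneg_C1_solution lam \<kappa> \<theta> u v"
    and pos: "0 < lam" "0 < \<kappa>" "0 < \<theta>"
  shows "cone_system bdist lam UNIV half_space \<theta> \<kappa>
    (\<lambda>x. u x powr (- \<theta>)) (\<lambda>y. if y \<in> half_space then v y powr (- \<kappa>) else 0)"
proof -
  interpret homogeneous_kernel "bdist :: 'a \<Rightarrow> 'a \<times> real \<Rightarrow> real" lam
    using pos(1) by (rule bdist_kernel)
  define H where "H = (half_space :: ('a \<times> real) set)"
  have H: "open H" "(0, 1) \<in> H"
    by (simp_all add: H_def open_half_space) (simp add: half_space_def)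
  have [measurable]: "H \<in> sets borel" using H by simp
  have u_eq: "ennreal (u x) =
      (\<integral>\<^sup>+y. ennreal (bdist x y powr lam) * neg_powr (v y) \<kappa> * indicator H y \<partial>lborel)" for x
    using sol by (simp add: nonneg_C1_solution_def H_def)
  have v_eq: "ennreal (v y) =
      (\<integral>\<^sup>+x. ennreal (bdist x y powr lam) * neg_powr (u x) \<theta> \<partial>lborel)" if "y \<in> H" for y
    using sol that by (simp add: nonneg_C1_solution_def H_def)
  have nonneg: "0 \<le> u x" "y \<in> H \<Longrightarrow> 0 \<le> v y" for x y
    using sol by (auto simp: nonneg_C1_solution_def H_def)
  have "continuous_on UNIV u" "continuous_on H v"
    using sol by (auto simp: nonneg_C1_solution_def H_def intro: C1_on_imp_continuous_on)
  then have [measurable]: "u \<in> borel_measurable borel"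
    and v_restr: "(\<lambda>y. indicator H y *\<^sub>R v y) \<in> borel_measurable borel"
    using borel_measurable_continuous_on_indicator[of H v]
    by (auto intro: borel_measurable_continuous_onI)
  \<comment> \<open>Outside the half-space \<open>v\<close> is arbitrary and possibly not
    measurable; \<open>w\<close> cuts it off there without changing the integrals.\<close>
  define w where "w y = indicator H y *\<^sub>R v y" for y
  have [measurable]: "w \<in> borel_measurable borel" using v_restr by (simp add: w_def[abs_def])
  have wv: "y \<in> H \<Longrightarrow> w y = v y" for y by (simp add: w_def)
  define g where "g y = (if y \<in> H then v y powr (- \<kappa>) else 0)" for y
  have g_w: "g = (\<lambda>y. indicator H y * w y powr (- \<kappa>))"
    by (auto simp: g_def w_def indicator_def)
  have [measurable]: "g \<in> borel_measurable borel" unfolding g_w by measurable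
  have u_eq': "ennreal (u x) =
      (\<integral>\<^sup>+y. ennreal (bdist x y powr lam) * neg_powr (w y) \<kappa> * indicator H y \<partial>lborel)" for x
    unfolding u_eq by (intro nn_integral_cong) (auto simp: wv indicator_def)
  have u_pos: "0 < u x" for x
  proof -
    have "ennreal (u x) \<noteq> 0"
      unfolding u_eq'
    proof (rule nn_integral_pos_of_nonzero_on_open)
      fix y assume "y \<in> H"
      then show "ennreal (bdist x y powr lam) * neg_powr (w y) \<kappa> * indicator H y \<noteq> 0"
        using bdist_pos[of y x] by (auto simp: H_def neg_powr_nonzero)
    qed (use H in auto)
    then show ?thesis using nonneg(1)[of x] by (simp add: less_le)
  qed
  have v_pos: "0 < v y" if y: "y \<in> H" for y
  proof -
    have "ennreal (v y) \<noteq> 0"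
      unfolding v_eq[OF y]
    proof (rule nn_integral_pos_of_nonzero_on_open[where S = UNIV])
      fix x
      show "ennreal (bdist x y powr lam) * neg_powr (u x) \<theta> \<noteq> 0"
        using bdist_pos[of y x] y by (auto simp: H_def neg_powr_nonzero)
    qed auto
    then show ?thesis using nonneg(2)[OF y] by (simp add: less_le)
  qed
  have u_int: "has_bochner_integral lborel (\<lambda>y. bdist x y powr lam * g y) (u x)" for x
  proof (rule has_bochner_integral_nn_integral)
    show "(\<integral>\<^sup>+y. ennreal (bdist x y powr lam * g y) \<partial>lborel) = ennreal (u x)"
      unfolding u_eq
      by (intro nn_integral_cong)
        (auto simp: g_def neg_powr_pos v_pos ennreal_mult indicator_def)
    show "(\<lambda>y. bdist x y powr lam * g y) \<in> borel_measurable lborel" by measurable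
  qed (auto simp: nonneg g_def)
  have v_int: "has_bochner_integral lborel (\<lambda>x. bdist x y powr lam * u x powr (- \<theta>)) (v y)"
    if y: "y \<in> H" for y
  proof (rule has_bochner_integral_nn_integral)
    show "(\<integral>\<^sup>+x. ennreal (bdist x y powr lam * u x powr (- \<theta>)) \<partial>lborel) = ennreal (v y)"
      unfolding v_eq[OF y] by (intro nn_integral_cong) (simp add: neg_powr_pos u_pos ennreal_mult)
  qed (auto simp: nonneg y)
  have pot_u: "potential bdist lam g x = u x" for x
    using u_int[of x] unfolding potential_def by (rule has_bochner_integral_integral_eq)
  have pot_v: "potential (\<lambda>y x. bdist x y) lam (\<lambda>x. u x powr (- \<theta>)) y = v y" if "y \<in> H" for y
    using v_int[OF that] unfolding potential_def by (rule has_bochner_integral_integral_eq)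
  have "cone_system bdist lam UNIV H \<theta> \<kappa> (\<lambda>x. u x powr (- \<theta>)) g"
  proof
    show "H \<noteq> {}" using H by auto
    show "t *\<^sub>R y \<in> H" if "y \<in> H" "0 < t" for y t
      using that by (auto simp: H_def half_space_def)
    show "integrable lborel (\<lambda>y. bdist x y powr lam * g y)" for x
      using u_int by (rule integrable.intros)
    show "integrable lborel (\<lambda>x. bdist x y powr lam * u x powr (- \<theta>))" if "y \<in> H" for y
      using v_int[OF that] by (rule integrable.intros)
    show "0 < u x powr (- \<theta>)" for x using u_pos[of x] by simp
    show "0 < g y" if "y \<in> H" for y using v_pos[OF that] that by (simp add: g_def)
    show "g y = 0" if "y \<notin> H" for y using that by (simp add: g_def)
    show "u x powr (- \<theta>) = potential bdist lam g x powr (- \<theta>)" for x by (simp add: pot_u)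
    show "g y = potential (\<lambda>y x. bdist x y) lam (\<lambda>x. u x powr (- \<theta>)) y powr (- \<kappa>)"
      if "y \<in> H" for y using that by (simp add: pot_v g_def)
  qed (use pos H in auto)
  then show ?thesis unfolding g_def H_def .
qed

text \<open>The boundary is \<open>real ^ 'm\<close> with \<open>CARD('m) = n - 1\<close>. As
  division by zero yields 0, the conclusion also states that neither denominator vanishes.\<close>

theorem lemma1:
  fixes n :: nat and lam \<kappa> \<theta> :: real
  assumes "n \<ge> 3" and "CARD('m::finite) = n - 1"
    and "lam > 0" and "\<kappa> > 0" and "\<theta> > 0"
    and "\<exists>(u :: real ^ 'm \<Rightarrow> real) (v :: (real ^ 'm) \<times> real \<Rightarrow> real).
           nonneg_C1_solution lam \<kappa> \<theta> u v"
  shows "\<theta> \<noteq> 1 \<and> \<kappa> \<noteq> 1 \<and>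
    (real n - 1) / real n * (1 / (\<theta> - 1)) + 1 / (\<kappa> - 1) = lam / real n"
proof -
  obtain u :: "real ^ 'm \<Rightarrow> real" and v where "nonneg_C1_solution lam \<kappa> \<theta> u v"
    using assms(6) by blast
  then interpret cone_system "bdist :: real ^ 'm \<Rightarrow> (real ^ 'm) \<times> real \<Rightarrow> real" lam UNIV half_space
      \<theta> \<kappa> "\<lambda>x. u x powr (- \<theta>)" "\<lambda>y. if y \<in> half_space then v y powr (- \<kappa>) else 0"
    using assms(3-5) by (rule solution_cone_system)
  \<comment> \<open>Here \<open>q_gt_one\<close> gives \<open>1 < \<kappa>\<close>, and the swapped
    copy gives \<open>1 < \<theta>\<close>.\<close>
  interpret sw: cone_system "\<lambda>y x. bdist x y" lam half_space "UNIV :: (real ^ 'm) set" \<kappa> \<theta>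
    "\<lambda>y. if y \<in> half_space then v y powr (- \<kappa>) else 0" "\<lambda>x. u x powr (- \<theta>)"
    by (rule swap)
  have "real DIM(real ^ 'm) = real n - 1" "real DIM((real ^ 'm) \<times> real) = real n"
    using assms(1,2) by auto
  then have "(real n - 1) / (\<theta> - 1) + real n / (\<kappa> - 1) = lam"
    using balance by simp
  moreover have "(real n - 1) / real n * (1 / (\<theta> - 1)) + 1 / (\<kappa> - 1)
      = ((real n - 1) / (\<theta> - 1) + real n / (\<kappa> - 1)) / real n"
    using assms(1) by (simp add: add_divide_distrib)
  ultimately show ?thesis using q_gt_one sw.q_gt_one by simp
qed

end
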